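(* Let $q$ be a prime power, $n\ge 2$, and let $\mathcal{L}$ be a non-empty set of lines of $\mathrm{PG}(n,q)$ satisfying: (Pt) every point of $\mathrm{PG}(n,q)$ is incident with either $0$ or $q+1$ elements of $\mathcal{L}$; (Pl) every plane of $\mathrm{PG}(n,q)$ contains either $0$, $1$ or $q+1$ elements of $\mathcal{L}$; (Sd) every solid ($3$-dimensional subspace) of $\mathrm{PG}(n,q)$ contains either $0$, $1$, $q+1$ or $2q+1$ elements of $\mathcal{L}$; (To) $|\mathcal{L}|\le q^5+q^4+q^3+q^2+q+1$. Then the subspace of $\mathrm{PG}(n,q)$ spanned by the lines of $\mathcal{L}$ has dimension at most $6$ (i.e. $\mathcal{L}$ is contained in a $6$-dimensional subspace when $n\ge 6$).
   Context: A line is said to be contained in a subspace if it is a subset of it. *)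

theory Defs
  imports "HOL-Analysis.Analysis"
begin

text \<open>The projective space PG(n,q) is modelled by the vector space 'a^'n over a finite
field 'a with CARD('a) = q and CARD('n) = n+1. A projective subspace of projective
dimension k is a linear subspace of vector dimension k+1.\<close>

definition pg_subspace :: "nat \<Rightarrow> ('a::field ^ 'n) set \<Rightarrow> bool" where
  "pg_subspace k S \<longleftrightarrow> vec.subspace S \<and> vec.dim S = k + 1"

abbreviation pg_point :: "('a::field ^ 'n) set \<Rightarrow> bool" where "pg_point \<equiv> pg_subspace 0"
abbreviation pg_line :: "('a::field ^ 'n) set \<Rightarrow> bool" where "pg_line \<equiv> pg_subspace 1"
abbreviation pg_plane :: "('a::field ^ 'n) set \<Rightarrow> bool" where "pg_plane \<equiv> pg_subspace 2"
abbreviation pg_solid :: "('a::field ^ 'n) set \<Rightarrow> bool" where "pg_solid \<equiv> pg_subspace 3"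

end

theory Submission
  imports Defs
begin

text \<open>
  By (Pl) and (Sd) the \<open>q + 1\<close> lines through a point \<open>x\<close> form a full planar pencil, and the resulting
  geometry has no triangles and no quadrangles. Hence exactly \<open>q^4 + q^3 + q^2 + q + 1\<close> lines are near
  to a line \<open>K\<close>, meaning that some line of the set meets both. A line \<open>M\<close> far from \<open>K\<close> spans a solid
  with \<open>K\<close> which, by (Sd), contains \<open>q\<close> lines far from \<open>K\<close>. If \<open>H\<close> is a hyperplane not containing \<open>K\<close>,
  then at most \<open>2 q^2 + 1\<close> lines of \<open>H\<close> are near to \<open>K\<close>, while different far lines of \<open>H\<close> span different
  solids with \<open>K\<close>; with (To), \<open>H\<close> contains at most \<open>q^4 + 2 q^2 + 1\<close> lines.

  On the other hand, the average number of lines in a hyperplane through a subspace \<open>C\<close> of codimension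
  two is the number of points in \<open>C\<close>. If two pencil planes are disjoint, then the solids spanned by
  a line of each provide at least \<open>q^4 + 2 q^2 + 2 q + 1\<close> points in their 5-dimensional span, which lies
  in such a \<open>C\<close> as soon as the lines span a space of dimension at least 7. If no two pencil planes are
  disjoint, then the number of lines is so small that two collinear points already suffice.
\<close>

section \<open>Subspaces over a finite field\<close>

definition ssum :: "('a::field ^ 'n) set \<Rightarrow> ('a ^ 'n) set \<Rightarrow> ('a ^ 'n) set" where
  "ssum A B = {a + b | a b. a \<in> A \<and> b \<in> B}"

lemma subspace_ssum: "vec.subspace A \<Longrightarrow> vec.subspace B \<Longrightarrow> vec.subspace (ssum A B)"
  unfolding ssum_def by (rule vec.subspace_sums)

lemma ssum_upper1: "vec.subspace B \<Longrightarrow> A \<subseteq> ssum A B"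
  unfolding ssum_def using vec.subspace_0[of B] by (smt (verit) add.right_neutral mem_Collect_eq subsetI)

lemma ssum_upper2: "vec.subspace A \<Longrightarrow> B \<subseteq> ssum A B"
  unfolding ssum_def using vec.subspace_0[of A] by (smt (verit) add.left_neutral mem_Collect_eq subsetI)

lemma ssum_least: "vec.subspace T \<Longrightarrow> A \<subseteq> T \<Longrightarrow> B \<subseteq> T \<Longrightarrow> ssum A B \<subseteq> T"
  unfolding ssum_def using vec.subspace_add by blast

text \<open>Each vector of the larger span is \<open>k *s b + s\<close> in exactly one way: two
  different scalars \<open>k\<close> would put \<open>b\<close> into
  \<open>vec.span B\<close>.\<close>

lemma card_span_insert:
  fixes b :: "'a::{field,finite} ^ 'n"
  assumes b: "b \<notin> vec.span B"
  shows "card (vec.span (insert b B)) = CARD('a) * card (vec.span B)"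
proof -
  let ?f = "\<lambda>(k, s). k *s b + s"
  have inj: "inj_on ?f (UNIV \<times> vec.span B)"
  proof (rule inj_onI, clarify)
    fix k s k' s' assume s: "s \<in> vec.span B" "s' \<in> vec.span B" and e: "k *s b + s = k' *s b + s'"
    have d: "(k - k') *s b = s' - s" using e by (simp add: vector_sub_rdistrib algebra_simps)
    have "k = k'"
    proof (rule ccontr)
      assume "k \<noteq> k'"
      then have "b = (1 / (k - k')) *s ((k - k') *s b)"
        by (metis vector_smult_assoc vector_smult_lid nonzero_divide_eq_eq right_minus_eq)
      then have "b = (1 / (k - k')) *s (s' - s)" unfolding d .
      then show False using b s by (metis vec.span_diff vec.span_scale)
    qed
    then show "k = k' \<and> s = s'" using e by simp
  qed
  have img: "vec.span (insert b B) = ?f ` (UNIV \<times> vec.span B)"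
  proof (intro set_eqI iffI)
    fix x assume "x \<in> vec.span (insert b B)"
    then obtain k where "x - k *s b \<in> vec.span B" by (auto simp: vec.span_insert)
    then show "x \<in> ?f ` (UNIV \<times> vec.span B)"
      by (intro image_eqI[of _ _ "(k, x - k *s b)"]) auto
  next
    fix x assume "x \<in> ?f ` (UNIV \<times> vec.span B)"
    then obtain k s where ks: "s \<in> vec.span B" "x = k *s b + s" by auto
    then have "x - k *s b \<in> vec.span B" by simp
    then show "x \<in> vec.span (insert b B)" unfolding vec.span_insert by blast
  qed
  show ?thesis unfolding img by (simp add: card_image[OF inj] card_cartesian_product)
qed

lemma card_subspace:
  fixes S :: "('a::{field,finite} ^ 'n) set"
  assumes "vec.subspace S"
  shows "card S = CARD('a) ^ vec.dim S"
proof -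
  have *: "card (vec.span B) = CARD('a) ^ card B" if "finite B" "vec.independent B" for B :: "('a ^ 'n) set"
    using that
  proof (induction B rule: finite_induct)
    case (insert b B)
    then have "b \<notin> vec.span B" "vec.independent B" by (auto simp: vec.independent_insert)
    then show ?case using insert by (simp add: card_span_insert)
  qed simp
  obtain B where B: "B \<subseteq> S" "vec.independent B" "S \<subseteq> vec.span B" "card B = vec.dim S"
    using vec.basis_exists by blast
  then have "vec.span B = S" using assms by (simp add: vec.span_subspace)
  then show ?thesis using *[of B] B vec.finiteI_independent by auto
qed

lemma one_less_card_field: "1 < CARD('a::{field,finite})"
proof -
  have "card {0::'a, 1} \<le> CARD('a)" by (intro card_mono) auto
  then show ?thesis by simp
qed

text \<open>Addition maps \<open>A \<times> B\<close> onto \<open>ssum A B\<close>, and every fibre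
  is a copy of \<open>A \<inter> B\<close>: the pairs over \<open>a + b\<close> are
  \<open>(a + t, b - t)\<close>.\<close>

lemma card_ssum:
  fixes A B :: "('a::{field,finite} ^ 'n) set"
  assumes A: "vec.subspace A" and B: "vec.subspace B"
  shows "card (ssum A B) * card (A \<inter> B) = card A * card B"
proof -
  let ?R = "\<lambda>p s. fst p + snd p = (s::'a^'n)"
  have fib: "card {p \<in> A \<times> B. ?R p s} = card (A \<inter> B)" if s: "s \<in> ssum A B" for s
  proof -
    obtain a b where ab: "a \<in> A" "b \<in> B" "s = a + b" using s by (auto simp: ssum_def)
    have "bij_betw (\<lambda>t. (a + t, b - t)) (A \<inter> B) {p \<in> A \<times> B. ?R p s}"
    proof (rule bij_betw_imageI)
      show "inj_on (\<lambda>t. (a + t, b - t)) (A \<inter> B)" by (auto intro: inj_onI)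
      show "(\<lambda>t. (a + t, b - t)) ` (A \<inter> B) = {p \<in> A \<times> B. ?R p s}"
      proof (intro set_eqI iffI)
        fix p assume p: "p \<in> {p \<in> A \<times> B. ?R p s}"
        then obtain c d where cd: "p = (c, d)" "c \<in> A" "d \<in> B" "c + d = a + b" using ab by auto
        have "c - a = b - d" using cd(4) by (simp add: algebra_simps)
        then have "c - a \<in> A \<inter> B" using A B ab cd by (metis IntI vec.subspace_diff)
        moreover have "p = (a + (c - a), b - (c - a))" using cd by (simp add: algebra_simps)
        ultimately show "p \<in> (\<lambda>t. (a + t, b - t)) ` (A \<inter> B)" by blast
      qed (use ab A B in \<open>auto intro: vec.subspace_add vec.subspace_diff\<close>)
    qed
    from bij_betw_same_card[OF this] show ?thesis by (rule sym)
  qed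
  have "(\<Sum>p\<in>A \<times> B. card {s \<in> ssum A B. ?R p s}) = card (A \<inter> B) * card (ssum A B)"
    by (rule sum_multicount) (auto intro: fib)
  moreover have "card {s \<in> ssum A B. ?R p s} = 1" if "p \<in> A \<times> B" for p
  proof -
    have "fst p + snd p \<in> ssum A B" using that unfolding ssum_def mem_Times_iff by blast
    then have "{s \<in> ssum A B. ?R p s} = {fst p + snd p}" by auto
    then show ?thesis by simp
  qed
  ultimately show ?thesis by (simp add: card_cartesian_product)
qed

text \<open>The dimension formula is \<open>card_ssum\<close> read in exponents of the field
  size.\<close>

lemma dim_ssum:
  fixes A B :: "('a::{field,finite} ^ 'n) set"
  assumes A: "vec.subspace A" and B: "vec.subspace B"
  shows "vec.dim (ssum A B) + vec.dim (A \<inter> B) = vec.dim A + vec.dim B"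
proof -
  have "CARD('a) ^ (vec.dim (ssum A B) + vec.dim (A \<inter> B)) = CARD('a) ^ (vec.dim A + vec.dim B)"
    using card_ssum[OF A B] A B
    by (simp add: card_subspace subspace_ssum vec.subspace_inter power_add)
  then show ?thesis using one_less_card_field[where 'a='a] by (simp add: power_inject_exp)
qed

section \<open>Subspaces of small dimension, and criteria for intersection and equality\<close>

lemma dim_0_iff: "vec.subspace A \<Longrightarrow> vec.dim A = 0 \<longleftrightarrow> A = {0::'a::field ^ 'n}"
  using vec.dim_eq_0 vec.subspace_0 by (metis empty_iff subset_singletonD order_refl)

lemma subspace_nonzero:
  "vec.subspace A \<Longrightarrow> 0 < vec.dim A \<Longrightarrow> \<exists>v\<in>A. v \<noteq> (0::'a::field ^ 'n)"
  using dim_0_iff[of A] vec.subspace_0[of A] by fastforce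

lemma subspace_pos_dim:
  "vec.subspace A \<Longrightarrow> v \<in> A \<Longrightarrow> v \<noteq> (0::'a::field ^ 'n) \<Longrightarrow> 0 < vec.dim A"
  using dim_0_iff[of A] by auto

text \<open>Used to force two subspaces of a plane, a solid or a larger space to have a point in
  common.\<close>

lemma dim_Int_ge:
  fixes A B :: "('a::{field,finite} ^ 'n) set"
  assumes "vec.subspace A" "vec.subspace B" "vec.subspace T" "A \<subseteq> T" "B \<subseteq> T"
  shows "vec.dim A + vec.dim B \<le> vec.dim T + vec.dim (A \<inter> B)"
  using dim_ssum[OF assms(1,2)] vec.dim_subset[OF ssum_least[OF assms(3-5)]] by linarith

lemma subspace_eqI:
  "vec.subspace A \<Longrightarrow> vec.subspace B \<Longrightarrow> A \<subseteq> B \<Longrightarrow> vec.dim B \<le> vec.dim A \<Longrightarrow> A = (B :: ('a::field ^ 'n) set)"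
  by (simp add: vec.subspace_dim_equal)

lemma dim_Int_less:
  fixes A B :: "('a::field ^ 'n) set"
  assumes "vec.subspace A" "vec.subspace B" "\<not> A \<subseteq> B"
  shows "vec.dim (A \<inter> B) < vec.dim A"
proof (rule ccontr)
  assume "\<not> vec.dim (A \<inter> B) < vec.dim A"
  then have "A \<inter> B = A"
    by (intro subspace_eqI vec.subspace_inter assms(1,2)) simp_all
  then show False using assms(3) by blast
qed

lemma dim_span1: "a \<noteq> 0 \<Longrightarrow> vec.dim (vec.span {a :: 'a::field ^ 'n}) = 1"
  by (simp add: vec.dim_span_eq_card_independent)

lemma dim_span2: "a \<noteq> 0 \<Longrightarrow> b \<notin> vec.span {a} \<Longrightarrow> vec.dim (vec.span {a, b :: 'a::field ^ 'n}) = 2"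
  by (subst insert_commute, subst vec.dim_span_eq_card_independent)
     (auto simp: vec.independent_insert vec.span_base card_insert_if)

lemma span_subset_subspace: "vec.subspace M \<Longrightarrow> a \<in> M \<Longrightarrow> vec.span {a} \<subseteq> (M :: ('a::field ^ 'n) set)"
  by (simp add: vec.span_minimal)

lemma dim1_eq_span:
  "vec.subspace M \<Longrightarrow> vec.dim M \<le> 1 \<Longrightarrow> a \<in> M \<Longrightarrow> a \<noteq> 0 \<Longrightarrow> M = vec.span {a :: 'a::field ^ 'n}"
  by (metis subspace_eqI dim_span1 span_subset_subspace vec.subspace_span)

lemma dim2_eq_span:
  "vec.subspace M \<Longrightarrow> vec.dim M = 2 \<Longrightarrow> a \<in> M \<Longrightarrow> b \<in> M \<Longrightarrow> a \<noteq> 0 \<Longrightarrow> b \<notin> vec.span {a}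
   \<Longrightarrow> M = vec.span {a, b :: 'a::field ^ 'n}"
  by (metis subspace_eqI dim_span2 vec.subspace_span vec.span_minimal empty_subsetI insert_subset le_refl)

lemma card_span1: "a \<noteq> 0 \<Longrightarrow> card (vec.span {a :: 'a::{field,finite} ^ 'n}) = CARD('a)"
  by (simp add: card_subspace dim_span1)

lemma span1_commute: "a \<noteq> 0 \<Longrightarrow> a \<in> vec.span {b} \<Longrightarrow> b \<in> vec.span {a :: 'a::field ^ 'n}"
  by (metis vec.in_span_insert vec.span_empty singletonD)

section \<open>Algebra of sums of sets, and extension of a subspace to a prescribed
  dimension\<close>

lemma ssumI: "a \<in> A \<Longrightarrow> b \<in> B \<Longrightarrow> a + b \<in> ssum A B"
  unfolding ssum_def by blast

lemma ssum_commute: "ssum A B = ssum B A"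
proof -
  have "ssum A B \<subseteq> ssum B A" for A B :: "('a ^ 'n) set"
  proof
    fix v assume "v \<in> ssum A B"
    then obtain a b where "a \<in> A" "b \<in> B" "v = a + b" by (auto simp: ssum_def)
    then show "v \<in> ssum B A" using ssumI[of b B a A] by (simp add: add.commute)
  qed
  then show ?thesis by blast
qed

lemma ssum_zero1: "ssum {0} B = B" and ssum_zero2: "ssum A {0} = A"
  by (simp_all add: ssum_def)

lemma ssum_mono: "A \<subseteq> A' \<Longrightarrow> B \<subseteq> B' \<Longrightarrow> ssum A B \<subseteq> ssum A' B'"
  unfolding ssum_def by blast

lemma ssum_Un1: "ssum (A \<union> A') B = ssum A B \<union> ssum A' B"
  and ssum_Un2: "ssum A (B \<union> B') = ssum A B \<union> ssum A B'"
  and ssum_UN1: "ssum (\<Union>i\<in>I. F i) B = (\<Union>i\<in>I. ssum (F i) B)"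
  and ssum_UN2: "ssum A (\<Union>i\<in>I. F i) = (\<Union>i\<in>I. ssum A (F i))"
  unfolding ssum_def by blast+

lemma ssum_span_dim:
  fixes C :: "('a::{field,finite} ^ 'n) set"
  assumes C: "vec.subspace C" and d: "d \<notin> C"
  shows "vec.dim (ssum C (vec.span {d})) = vec.dim C + 1"
proof -
  have d0: "d \<noteq> 0" using C d vec.subspace_0 by blast
  have "\<not> vec.span {d} \<subseteq> C" using d vec.span_base[of d "{d}"] by blast
  from dim_Int_less[OF vec.subspace_span C this] have "vec.dim (C \<inter> vec.span {d}) < 1"
    unfolding dim_span1[OF d0] by (simp only: Int_commute)
  then show ?thesis using dim_ssum[OF C vec.subspace_span[of "{d}"]] unfolding dim_span1[OF d0] by linarith
qed

lemma subspace_extend: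
  fixes X U :: "('a::{field,finite} ^ 'n) set"
  assumes X: "vec.subspace X" "X \<subseteq> U" and U: "vec.subspace U" and k: "vec.dim X \<le> k" "k \<le> vec.dim U"
  shows "\<exists>C. vec.subspace C \<and> X \<subseteq> C \<and> C \<subseteq> U \<and> vec.dim C = k"
  using k
proof (induction k rule: dec_induct)
  case base
  then show ?case using X by blast
next
  case (step k)
  then obtain C where C: "vec.subspace C" "X \<subseteq> C" "C \<subseteq> U" "vec.dim C = k" by auto
  have "C \<noteq> U" using C step by auto
  then obtain d where d: "d \<in> U" "d \<notin> C" using C by blast
  let ?C = "ssum C (vec.span {d})"
  have "?C \<subseteq> U" using C U d by (intro ssum_least span_subset_subspace)
  moreover have "C \<subseteq> ?C" by (simp add: ssum_upper1)
  moreover have "vec.dim ?C = Suc k" using ssum_span_dim[OF C(1) d(2)] C by simp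
  moreover have "vec.subspace ?C" using C by (simp add: subspace_ssum)
  ultimately show ?case using C by blast
qed

lemma card_le_1I: "finite A \<Longrightarrow> (\<And>x y. x \<in> A \<Longrightarrow> y \<in> A \<Longrightarrow> x = y) \<Longrightarrow> card A \<le> 1"
  by (simp add: card_le_Suc0_iff_eq)

section \<open>Pencils of lines\<close>

locale line_set =
  fixes \<L> :: "('a::{field,finite} ^ 'n) set set" and q :: nat
  assumes q_def: "q = CARD('a)"
    and lines: "\<forall>L\<in>\<L>. pg_line L"
    and Pt: "\<forall>P. pg_point P \<longrightarrow> card {L\<in>\<L>. P \<subseteq> L} \<in> {0, q + 1}"
    and Pl: "\<forall>\<pi>. pg_plane \<pi> \<longrightarrow> card {L\<in>\<L>. L \<subseteq> \<pi>} \<in> {0, 1, q + 1}"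
    and Sd: "\<forall>S. pg_solid S \<longrightarrow> card {L\<in>\<L>. L \<subseteq> S} \<in> {0, 1, q + 1, 2 * q + 1}"
begin

text \<open>Projective points are counted through their representing vectors: \<open>pts\<close> consists of the nonzero
  vectors on lines of \<open>\<L>\<close>, so every point of the geometry contributes \<open>q - 1\<close> elements.\<close>

definition thru :: "'a ^ 'n \<Rightarrow> ('a ^ 'n) set set" where "thru a = {M \<in> \<L>. a \<in> M}"
definition lin :: "('a ^ 'n) set \<Rightarrow> ('a ^ 'n) set set" where "lin S = {M \<in> \<L>. M \<subseteq> S}"
definition pts :: "('a ^ 'n) set" where "pts = {v. v \<noteq> 0 \<and> thru v \<noteq> {}}"
text \<open>A priori only a union of lines; \<open>pl_props\<close> shows that for
  \<open>a \<in> pts\<close> it is a plane, the one carrying the pencil at \<open>a\<close>.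
  Membership means collinearity with \<open>a\<close> in the geometry.\<close>

definition pl :: "'a ^ 'n \<Rightarrow> ('a ^ 'n) set" where "pl a = \<Union>(thru a)"

lemma q_gt_1: "1 < q"
  unfolding q_def by (rule one_less_card_field)

lemma line_subspace: "M \<in> \<L> \<Longrightarrow> vec.subspace M"
  and line_dim: "M \<in> \<L> \<Longrightarrow> vec.dim M = 2"
  using lines by (auto simp: pg_subspace_def)

lemma card_sub: "vec.subspace (S :: ('a ^ 'n) set) \<Longrightarrow> card S = q ^ vec.dim S"
  unfolding q_def by (rule card_subspace)

lemma line_card: "M \<in> \<L> \<Longrightarrow> card M = q^2"
  by (simp add: card_sub line_subspace line_dim)

lemma ptsI: "v \<noteq> 0 \<Longrightarrow> v \<in> M \<Longrightarrow> M \<in> \<L> \<Longrightarrow> v \<in> pts"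
  by (auto simp: pts_def thru_def)

lemma pts_nonzero: "v \<in> pts \<Longrightarrow> v \<noteq> 0"
  by (simp add: pts_def)

lemma thruD: "M \<in> thru a \<Longrightarrow> M \<in> \<L>" "M \<in> thru a \<Longrightarrow> a \<in> M"
  by (auto simp: thru_def)

lemma linD: "M \<in> lin S \<Longrightarrow> M \<in> \<L>" "M \<in> lin S \<Longrightarrow> M \<subseteq> S"
  by (auto simp: lin_def)

lemma lin_mono: "S \<subseteq> T \<Longrightarrow> lin S \<subseteq> lin T"
  by (auto simp: lin_def)

lemma span_subset_line: "M \<in> \<L> \<Longrightarrow> a \<in> M \<Longrightarrow> vec.span {a} \<subseteq> M"
  by (simp add: line_subspace span_subset_subspace)

section \<open>Numbers of lines through a point, in a plane and in a solid\<close>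

lemma card_thru:
  assumes "v \<in> pts" shows "card (thru v) = q + 1"
proof -
  have v: "v \<noteq> 0" "thru v \<noteq> {}" using assms by (auto simp: pts_def)
  have "{L\<in>\<L>. vec.span {v} \<subseteq> L} = thru v"
    using line_subspace span_subset_subspace vec.span_base[of v "{v}"] by (fastforce simp: thru_def)
  moreover have "pg_point (vec.span {v})" using v by (simp add: pg_subspace_def dim_span1)
  ultimately have "card (thru v) \<in> {0, q + 1}" using Pt by metis
  then show ?thesis using v by (simp add: card_eq_0_iff)
qed

lemma lines_Int:
  assumes "M \<in> \<L>" "T \<in> \<L>" "M \<noteq> T" "a \<in> M" "a \<in> T" "a \<noteq> 0"
  shows "M \<inter> T = vec.span {a}"
proof (rule dim1_eq_span)
  show s: "vec.subspace (M \<inter> T)" using assms line_subspace by (simp add: vec.subspace_inter)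
  have "\<not> M \<subseteq> T"
    using subspace_eqI[of M T] assms(1-3) by (auto simp: line_subspace line_dim)
  from dim_Int_less[OF line_subspace line_subspace this] assms(1,2)
  show "vec.dim (M \<inter> T) \<le> 1" by (simp add: line_dim)
qed (use assms in auto)

lemma dim_line_sum:
  assumes "M \<in> \<L>" "T \<in> \<L>" "M \<noteq> T" "a \<in> M" "a \<in> T" "a \<noteq> 0"
  shows "vec.dim (ssum M T) = 3"
  using dim_ssum[of M T] lines_Int[OF assms] assms by (simp add: line_subspace line_dim)

lemma card_lin_plane:
  assumes "vec.subspace S" "vec.dim S = 3" "M \<in> lin S" "T \<in> lin S" "M \<noteq> T"
  shows "card (lin S) = q + 1"
proof -
  have "card (lin S) \<in> {0, 1, q + 1}" using Pl assms(1,2) by (simp add: pg_subspace_def lin_def)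
  moreover have "card {M, T} \<le> card (lin S)" using assms by (intro card_mono) auto
  ultimately show ?thesis using assms(5) by auto
qed

lemma card_lin_solid:
  assumes "vec.subspace S" "vec.dim S = 4"
  shows "card (lin S) \<le> 2 * q + 1"
    and "M \<in> lin S \<Longrightarrow> T \<in> lin S \<Longrightarrow> M \<noteq> T \<Longrightarrow> q + 1 \<le> card (lin S)"
proof -
  have c: "card (lin S) \<in> {0, 1, q + 1, 2 * q + 1}" using Sd assms by (simp add: pg_subspace_def lin_def)
  then show "card (lin S) \<le> 2 * q + 1" by auto
  assume "M \<in> lin S" "T \<in> lin S" "M \<noteq> T"
  then have "card {M, T} \<le> card (lin S)" by (intro card_mono) auto
  then show "q + 1 \<le> card (lin S)" using c \<open>M \<noteq> T\<close> by auto
qed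

lemma card_lin_Int:
  assumes "vec.subspace S" "vec.subspace T" "vec.dim S = 3" "vec.dim T = 3" "S \<noteq> T"
  shows "card (lin S \<inter> lin T) \<le> 1"
proof -
  have s: "vec.subspace (S \<inter> T)" using assms by (simp add: vec.subspace_inter)
  have "\<not> S \<subseteq> T" using subspace_eqI[of S T] assms by auto
  from dim_Int_less[OF assms(1,2) this] have "vec.dim (S \<inter> T) \<le> 2" using assms(3) by simp
  then have "M = S \<inter> T" if "M \<in> lin S \<inter> lin T" for M
    using that s by (intro subspace_eqI) (auto simp: lin_def line_subspace line_dim)
  then have "lin S \<inter> lin T \<subseteq> {S \<inter> T}" by blast
  then show ?thesis using card_mono[of "{S \<inter> T}"] by fastforce
qed

text \<open>Suppose a line \<open>K\<close> through \<open>a\<close> leaves the plane of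
  \<open>M1\<close> and \<open>M2\<close>. The planes \<open>M1 M2\<close>, \<open>M1 K\<close> and
  \<open>M2 K\<close> lie in one solid, have \<open>q + 1\<close> lines each by (Pl), and pairwise
  share at most one line. That gives at least \<open>3 q\<close> lines in the solid, more than the
  \<open>2 q + 1\<close> allowed by (Sd). So the pencil lies in the plane, and both have
  \<open>q + 1\<close> lines.\<close>

lemma thru_eq_lin:
  assumes a: "a \<in> pts" and M: "M1 \<in> thru a" "M2 \<in> thru a" "M1 \<noteq> M2"
  shows "thru a = lin (ssum M1 M2)"
proof -
  have a0: "a \<noteq> 0" using a by (rule pts_nonzero)
  note D = thruD[OF M(1)] thruD[OF M(2)]
  let ?p = "ssum M1 M2"
  have p: "vec.subspace ?p" "vec.dim ?p = 3" "M1 \<subseteq> ?p" "M2 \<subseteq> ?p"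
    using D M(3) a0 by (auto intro: subspace_ssum line_subspace dim_line_sum ssum_upper1[THEN subsetD] ssum_upper2[THEN subsetD])
  have "M1 \<in> lin ?p" "M2 \<in> lin ?p" using p D by (auto simp: lin_def)
  note cp = card_lin_plane[OF p(1,2) this M(3)]
  have sub: "thru a \<subseteq> lin ?p"
  proof (rule ccontr)
    assume "\<not> thru a \<subseteq> lin ?p"
    then obtain K where K: "K \<in> \<L>" "a \<in> K" "\<not> K \<subseteq> ?p" by (auto simp: thru_def lin_def)
    then have ne: "M1 \<noteq> K" "M2 \<noteq> K" using p by auto
    let ?S = "ssum ?p K"
    have sK: "vec.subspace K" "vec.dim K = 2" using K line_subspace line_dim by auto
    have "vec.dim (?p \<inter> K) = 1"
    proof -
      have s: "vec.subspace (?p \<inter> K)" using p sK by (simp add: vec.subspace_inter)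
      have "vec.dim (?p \<inter> K) \<le> 1"
        using dim_Int_less[OF sK(1) p(1) K(3)] sK(2) by (simp add: Int_commute)
      moreover have "a \<in> ?p \<inter> K" using p(3) D(2) K(2) by blast
      then have "0 < vec.dim (?p \<inter> K)" using subspace_pos_dim[OF s _ a0] by blast
      ultimately show ?thesis by simp
    qed
    then have S: "vec.subspace ?S" "vec.dim ?S = 4"
      using dim_ssum[OF p(1) sK(1)] p sK by (auto intro: subspace_ssum)
    have SU: "?p \<subseteq> ?S" "K \<subseteq> ?S" using p sK by (auto intro: ssum_upper1[THEN subsetD] ssum_upper2[THEN subsetD])
    have Q: "vec.subspace (ssum M K) \<and> vec.dim (ssum M K) = 3 \<and> M \<subseteq> ssum M K \<and> K \<subseteq> ssum M K
        \<and> ssum M K \<subseteq> ?S \<and> card (lin (ssum M K)) = q + 1"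
      if MM: "M \<in> thru a" "M \<noteq> K" "M \<subseteq> ?p" for M
    proof -
      have L: "M \<in> \<L>" "a \<in> M" using thruD MM by auto
      have 1: "vec.subspace (ssum M K)" "vec.dim (ssum M K) = 3" "M \<subseteq> ssum M K" "K \<subseteq> ssum M K"
        using L K MM a0 sK by (auto intro: subspace_ssum line_subspace dim_line_sum ssum_upper1[THEN subsetD] ssum_upper2[THEN subsetD])
      have "ssum M K \<subseteq> ?S" using S SU MM by (intro ssum_least) auto
      moreover have "card (lin (ssum M K)) = q + 1"
        using 1 L K MM by (intro card_lin_plane[of _ M K]) (auto simp: lin_def)
      ultimately show ?thesis using 1 by blast
    qed
    note Q1 = Q[OF M(1) ne(1) p(3)] and Q2 = Q[OF M(2) ne(2) p(4)]
    have n1: "?p \<noteq> ssum M1 K" "?p \<noteq> ssum M2 K" using K Q1 Q2 by auto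
    have n2: "ssum M1 K \<noteq> ssum M2 K"
    proof
      assume e: "ssum M1 K = ssum M2 K"
      then have "?p \<subseteq> ssum M1 K" using Q1 Q2 by (intro ssum_least) auto
      then have "?p = ssum M1 K" using p Q1 by (intro subspace_eqI) auto
      then show False using n1 by simp
    qed
    let ?A = "lin ?p" and ?B = "lin (ssum M1 K)" and ?C = "lin (ssum M2 K)"
    have "card (?A \<inter> ?B) \<le> 1" by (rule card_lin_Int) (use p Q1 n1 in blast)+
    moreover have "card (?A \<inter> ?C) \<le> 1" by (rule card_lin_Int) (use p Q2 n1 in blast)+
    moreover have "card (?B \<inter> ?C) \<le> 1" by (rule card_lin_Int) (use Q1 Q2 n2 in blast)+
    moreover have "card ((?A \<union> ?B) \<inter> ?C) \<le> card (?A \<inter> ?C) + card (?B \<inter> ?C)"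
      by (simp add: Int_Un_distrib2 card_Un_le)
    moreover have "card (?A \<union> ?B) + card (?A \<inter> ?B) = card ?A + card ?B"
      by (rule card_Un_Int[symmetric]) simp_all
    moreover have "card (?A \<union> ?B \<union> ?C) + card ((?A \<union> ?B) \<inter> ?C) = card (?A \<union> ?B) + card ?C"
      by (rule card_Un_Int[symmetric]) simp_all
    moreover have "card (?A \<union> ?B \<union> ?C) \<le> card (lin ?S)"
      using SU Q1 Q2 by (intro card_mono) (auto simp: lin_def)
    moreover have "card (lin ?S) \<le> 2 * q + 1" using S by (rule card_lin_solid)
    ultimately show False using Q1 Q2 cp q_gt_1 by linarith
  qed
  show ?thesis using sub cp card_thru[OF a] by (intro card_subset_eq) auto
qed

lemma two_thru:
  assumes "a \<in> pts" obtains M1 M2 where "M1 \<in> thru a" "M2 \<in> thru a" "M1 \<noteq> M2"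
proof -
  have "1 < card (thru a)" using card_thru[OF assms] q_gt_1 by simp
  then obtain x y where "x \<in> thru a" "y \<in> thru a" "x \<noteq> y"
    using card_le_Suc0_iff_eq[of "thru a"] by fastforce
  then show ?thesis using that by blast
qed

text \<open>The \<open>q + 1\<close> lines are pairwise disjoint outside the point \<open>a\<close>,
  so their union has \<open>(q + 1) * (q^2 - q) + q\<close> vectors, as many as a plane.\<close>

lemma card_pl:
  assumes a: "a \<in> pts"
  shows "card (pl a) = q ^ 3"
proof -
  have a0: "a \<noteq> 0" using a by (rule pts_nonzero)
  let ?s = "vec.span {a}"
  have s: "card ?s = q" using card_span1[OF a0] q_def by simp
  have sub: "?s \<subseteq> M" if "M \<in> thru a" for M
    using that line_subspace by (intro span_subset_subspace) (auto simp: thru_def)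
  have "card (\<Union>M\<in>thru a. M - ?s) = (\<Sum>M\<in>thru a. card (M - ?s))"
  proof (rule card_UN_disjoint)
    show "\<forall>M\<in>thru a. \<forall>T\<in>thru a. M \<noteq> T \<longrightarrow> (M - ?s) \<inter> (T - ?s) = {}"
      using lines_Int a0 by (fastforce simp: thru_def)
  qed auto
  also have "\<dots> = (\<Sum>M\<in>thru a. q^2 - q)"
    using sub s by (intro sum.cong refl) (auto simp: card_Diff_subset line_card dest: thruD)
  also have "\<dots> = (q + 1) * (q^2 - q)" by (simp add: card_thru[OF a])
  finally have "card (\<Union>M\<in>thru a. M - ?s) = (q + 1) * (q^2 - q)" .
  moreover have "(\<Union>M\<in>thru a. M - ?s) = pl a - ?s" by (auto simp: pl_def)
  ultimately have c: "card (pl a - ?s) = (q + 1) * (q^2 - q)" by simp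
  obtain M where "M \<in> thru a" using two_thru[OF a] by blast
  then have "?s \<subseteq> pl a" using sub by (auto simp: pl_def)
  then have "card (pl a) = card (pl a - ?s) + card ?s"
    using card_Diff_subset[of ?s "pl a"] card_mono[of "pl a" ?s] by simp
  also have "\<dots> = (q + 1) * (q^2 - q) + q" using c s by simp
  also have "\<dots> = q^3" using q_gt_1 by (auto simp: power2_eq_square power3_eq_cube algebra_simps dest!: less_imp_Suc_add)
  finally show ?thesis .
qed

text \<open>The pencil lies in the plane spanned by two of its lines, and by \<open>card_pl\<close>
  it fills that plane.\<close>

lemma pl_props:
  assumes a: "a \<in> pts"
  shows pl_subspace: "vec.subspace (pl a)" and pl_dim: "vec.dim (pl a) = 3" and lin_pl: "lin (pl a) = thru a"
proof -
  obtain M1 M2 where M: "M1 \<in> thru a" "M2 \<in> thru a" "M1 \<noteq> M2" using two_thru[OF a] by blast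
  have a0: "a \<noteq> 0" using a by (rule pts_nonzero)
  let ?p = "ssum M1 M2"
  have p: "vec.subspace ?p" "vec.dim ?p = 3"
    using thruD[OF M(1)] thruD[OF M(2)] M(3) a0 by (auto intro: subspace_ssum line_subspace dim_line_sum)
  have e: "thru a = lin ?p" using thru_eq_lin[OF a M] .
  then have "pl a \<subseteq> ?p" by (auto simp: pl_def lin_def)
  then have "pl a = ?p" using card_pl[OF a] card_sub[OF p(1)] p by (intro card_subset_eq) auto
  then show "vec.subspace (pl a)" "vec.dim (pl a) = 3" "lin (pl a) = thru a" using p e by auto
qed

section \<open>Collinearity of points and the absence of triangles\<close>

lemma mem_pl: "c \<in> pl a \<longleftrightarrow> (\<exists>M\<in>\<L>. a \<in> M \<and> c \<in> M)"
  by (auto simp: pl_def thru_def)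

lemma pl_commute: "c \<in> pl a \<longleftrightarrow> a \<in> pl c"
  by (auto simp: mem_pl)

lemma pl_self: "a \<in> pts \<Longrightarrow> a \<in> pl a"
  by (auto simp: mem_pl pts_def thru_def)

lemma pl_pts: "c \<in> pl a \<Longrightarrow> c \<noteq> 0 \<Longrightarrow> c \<in> pts"
  by (auto simp: mem_pl pts_def thru_def)

lemma line_subset_pl: "a \<in> M \<Longrightarrow> M \<in> \<L> \<Longrightarrow> M \<subseteq> pl a"
  by (auto simp: mem_pl)

text \<open>A line with two different points in the plane lies in it, and all lines of
  \<open>\<L>\<close> in that plane belong to the pencil at \<open>a\<close>.\<close>

lemma line_in_pl:
  assumes "a \<in> pts" "M \<in> \<L>" "c \<in> M" "d \<in> M" "c \<in> pl a" "d \<in> pl a" "c \<noteq> 0" "d \<notin> vec.span {c}"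
  shows "a \<in> M"
proof -
  have "M = vec.span {c, d}" using assms by (intro dim2_eq_span) (auto simp: line_subspace line_dim)
  then have "M \<subseteq> pl a" using assms pl_subspace by (simp add: vec.span_minimal)
  then have "M \<in> thru a" using assms lin_pl[of a] by (auto simp: lin_def)
  then show ?thesis by (rule thruD)
qed

text \<open>If the planes shared a line, they would span a solid; they are different because
  \<open>c\<close> lies only in the second. For noncollinear \<open>a\<close> and \<open>c\<close>
  the two pencils have no common line, so the solid would contain \<open>2 * q + 2\<close> lines,
  one more than (Sd) permits.\<close>

lemma dim_pl_Int:
  assumes a: "a \<in> pts" and c: "c \<in> pts" and n: "c \<notin> pl a"
  shows "vec.dim (pl a \<inter> pl c) \<le> 1"
proof (rule ccontr)
  assume neg: "\<not> vec.dim (pl a \<inter> pl c) \<le> 1"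
  note A = pl_subspace[OF a] pl_dim[OF a] and C = pl_subspace[OF c] pl_dim[OF c]
  have S: "vec.subspace (ssum (pl a) (pl c))" using A C by (simp add: subspace_ssum)
  have U: "pl a \<subseteq> ssum (pl a) (pl c)" "pl c \<subseteq> ssum (pl a) (pl c)"
    using A C by (simp_all add: ssum_upper1 ssum_upper2)
  have d: "vec.dim (ssum (pl a) (pl c)) \<le> 4"
    using dim_ssum[OF A(1) C(1)] A C neg by linarith
  have "vec.dim (ssum (pl a) (pl c)) \<noteq> 3"
  proof
    assume "vec.dim (ssum (pl a) (pl c)) = 3"
    then have "pl a = ssum (pl a) (pl c)" using A S U by (intro subspace_eqI) auto
    then show False using n pl_self[OF c] U by blast
  qed
  moreover have "3 \<le> vec.dim (ssum (pl a) (pl c))" using vec.dim_subset[OF U(1)] A by simp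
  ultimately have d4: "vec.dim (ssum (pl a) (pl c)) = 4" using d by simp
  have "thru a \<inter> thru c = {}" using n by (auto simp: thru_def mem_pl)
  then have "card (thru a \<union> thru c) = 2 * q + 2"
    using card_thru[OF a] card_thru[OF c] by (simp add: card_Un_disjoint)
  moreover have "card (thru a \<union> thru c) \<le> card (lin (ssum (pl a) (pl c)))"
    using lin_mono[OF U(1)] lin_mono[OF U(2)] lin_pl[OF a] lin_pl[OF c] by (intro card_mono) simp_all
  ultimately show False using card_lin_solid(1)[OF S d4] by simp
qed

text \<open>No triangles: if \<open>M\<close> meets \<open>T\<close> and \<open>K\<close> in one and
  the same point, this point is \<open>a\<close>; otherwise \<open>M\<close> has two points in the
  plane \<open>pl a\<close> and belongs to the pencil by \<open>line_in_pl\<close>.\<close>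

lemma concurrent:
  assumes L: "T \<in> \<L>" "K \<in> \<L>" "M \<in> \<L>" "T \<noteq> K" and a: "a \<in> T" "a \<in> K" "a \<noteq> 0"
    and u: "u \<in> M" "u \<in> T" "u \<noteq> 0" and w: "w \<in> M" "w \<in> K" "w \<noteq> 0"
  shows "a \<in> M"
proof (cases "w \<in> vec.span {u}")
  case True
  then have "w \<in> T \<inter> K" using span_subset_line[OF L(1) u(2)] w(2) by blast
  then have "w \<in> vec.span {a}" using lines_Int[OF L(1,2,4) a] by simp
  then have "a \<in> vec.span {w}" by (rule span1_commute[OF w(3)])
  then show ?thesis using span_subset_line[OF L(3) w(1)] by blast
next
  case False
  have "a \<in> pts" using a L by (blast intro: ptsI)
  moreover have "u \<in> pl a" "w \<in> pl a" using L(1,2) a(1,2) u(2) w(2) by (auto simp: mem_pl)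
  ultimately show ?thesis using line_in_pl[of a M u w] L u w False by blast
qed

section \<open>Lines near to and far from a line\<close>

definition meets :: "('a ^ 'n) set \<Rightarrow> ('a ^ 'n) set \<Rightarrow> bool" where
  "meets M T \<longleftrightarrow> (\<exists>v. v \<noteq> 0 \<and> v \<in> M \<and> v \<in> T)"
definition star :: "('a ^ 'n) set \<Rightarrow> ('a ^ 'n) set set" where "star T = {M \<in> \<L>. meets M T}"
text \<open>For \<open>K \<in> \<L>\<close> this is the ball of radius two around \<open>K\<close>
  in the concurrency graph: since \<open>star T\<close> contains \<open>T\<close>, the line
  \<open>K\<close> and all lines meeting it are included.\<close>

definition near :: "('a ^ 'n) set \<Rightarrow> ('a ^ 'n) set set" where "near K = (\<Union>T\<in>star K. star T)"

lemma meets_commute: "meets M T \<longleftrightarrow> meets T M"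
  by (auto simp: meets_def)

lemma starI: "M \<in> \<L> \<Longrightarrow> v \<noteq> 0 \<Longrightarrow> v \<in> M \<Longrightarrow> v \<in> T \<Longrightarrow> M \<in> star T"
  by (auto simp: star_def meets_def)

lemma starE:
  assumes "M \<in> star T" obtains v where "M \<in> \<L>" "v \<noteq> 0" "v \<in> M" "v \<in> T"
  using assms by (auto simp: star_def meets_def)

lemma star_self:
  assumes "M \<in> \<L>" shows "M \<in> star M"
proof -
  obtain v where "v \<in> M" "v \<noteq> 0"
    using subspace_nonzero[OF line_subspace[OF assms]] line_dim[OF assms] by auto
  then show ?thesis using assms by (auto intro: starI)
qed

lemma star_subset_near: "K \<in> \<L> \<Longrightarrow> star K \<subseteq> near K"
  unfolding near_def using star_self by blast

lemma nearI: "T \<in> star K \<Longrightarrow> M \<in> star T \<Longrightarrow> M \<in> near K"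
  by (auto simp: near_def)

lemma near_commute: "K \<in> \<L> \<Longrightarrow> M \<in> \<L> \<Longrightarrow> M \<in> near K \<longleftrightarrow> K \<in> near M"
  by (auto simp: near_def star_def meets_commute)

section \<open>Counting the lines that meet a given line and the lines near to it\<close>

lemma card_Int_nonzero:
  assumes "M \<in> \<L>" "T \<in> \<L>" "M \<noteq> T" "v \<noteq> 0" "v \<in> M" "v \<in> T"
  shows "card (M \<inter> T - {0}) = q - 1"
proof -
  have "M \<inter> T = vec.span {v}" using assms by (intro lines_Int) auto
  then show ?thesis using card_span1[OF assms(4)] q_def by (simp add: vec.span_zero card_Diff_singleton)
qed

text \<open>Each of the \<open>q + 1\<close> points of \<open>T\<close> lies on \<open>q\<close>
  further lines, and a further line contains only one of these points. Both sides of the double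
  count carry the factor \<open>q - 1\<close>, the number of vectors representing a point.\<close>

lemma card_star:
  assumes T: "T \<in> \<L>"
  shows "card (star T) = q^2 + q + 1"
proof -
  have "(\<Sum>v\<in>T - {0}. card {M \<in> star T - {T}. v \<in> M}) = (q - 1) * card (star T - {T})"
  proof (rule sum_multicount)
    show "\<forall>M\<in>star T - {T}. card {v \<in> T - {0}. v \<in> M} = q - 1"
    proof
      fix M assume "M \<in> star T - {T}"
      then obtain v where v: "M \<in> \<L>" "M \<noteq> T" "v \<noteq> 0" "v \<in> M" "v \<in> T" by (auto simp: star_def meets_def)
      have "{v \<in> T - {0}. v \<in> M} = M \<inter> T - {0}" by auto
      then show "card {v \<in> T - {0}. v \<in> M} = q - 1" using card_Int_nonzero v T by simp
    qed
  qed auto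
  moreover have "card {M \<in> star T - {T}. v \<in> M} = q" if v: "v \<in> T - {0}" for v
  proof -
    have "{M \<in> star T - {T}. v \<in> M} = thru v - {T}" using v by (auto simp: thru_def star_def meets_def)
    moreover have "T \<in> thru v" using v T by (simp add: thru_def)
    moreover have "v \<in> pts" using v T by (auto intro: ptsI)
    ultimately show ?thesis by (simp add: card_thru)
  qed
  moreover have "card (T - {0}) = q^2 - 1"
    using line_card[OF T] vec.subspace_0[OF line_subspace[OF T]] by simp
  ultimately have "(q^2 - 1) * q = (q - 1) * card (star T - {T})" by simp
  moreover have "(q^2 - 1) * q = (q - 1) * (q * (q + 1))"
    using q_gt_1 by (auto simp: power2_eq_square algebra_simps dest!: less_imp_Suc_add)
  ultimately have "card (star T - {T}) = q * (q + 1)" using q_gt_1 by simp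
  moreover have "card (star T) = Suc (card (star T - {T}))"
    using star_self[OF T] by (intro card.remove) simp_all
  ultimately show ?thesis by (simp add: power2_eq_square algebra_simps)
qed

lemma star_Int_star:
  assumes "T \<in> \<L>" "K \<in> \<L>" "T \<noteq> K" "a \<noteq> 0" "a \<in> T" "a \<in> K"
  shows "star T \<inter> star K = thru a"
proof
  show "star T \<inter> star K \<subseteq> thru a"
  proof
    fix M assume "M \<in> star T \<inter> star K"
    then obtain u w where "M \<in> \<L>" "u \<noteq> 0" "u \<in> M" "u \<in> T" "w \<noteq> 0" "w \<in> M" "w \<in> K"
      unfolding star_def meets_def by blast
    then have "a \<in> M" using concurrent[OF assms(1,2) \<open>M \<in> \<L>\<close> assms(3,5,6,4)] by blast
    then show "M \<in> thru a" using \<open>M \<in> \<L>\<close> by (simp add: thru_def)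
  qed
  show "thru a \<subseteq> star T \<inter> star K" using assms unfolding thru_def star_def meets_def by blast
qed

text \<open>Two lines meeting \<open>K\<close> in different points and a further common transversal would close up
  to a quadrangle.\<close>

lemma star_disjoint:
  assumes K: "K \<in> \<L>" and T: "T \<in> star K" "T \<noteq> K" and T': "T' \<in> star K" "T' \<noteq> K" and ne: "T \<noteq> T'"
    and M: "M \<in> star T" "M \<in> star T'"
  shows "M \<in> star K"
proof (rule ccontr)
  assume n: "M \<notin> star K"
  obtain a where a: "T \<in> \<L>" "a \<noteq> 0" "a \<in> T" "a \<in> K" using T(1) by (rule starE)
  obtain a' where a': "T' \<in> \<L>" "a' \<noteq> 0" "a' \<in> T'" "a' \<in> K" using T'(1) by (rule starE)
  obtain c where c: "M \<in> \<L>" "c \<noteq> 0" "c \<in> M" "c \<in> T" using M(1) by (rule starE)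
  obtain c' where c': "c' \<noteq> 0" "c' \<in> M" "c' \<in> T'" using M(2) by (rule starE)
  have nK: "v \<notin> K" if "v \<in> M" "v \<noteq> 0" for v using n that c(1) by (auto intro: starI)
  have naM: "a \<notin> M" using nK a by blast
  have aP: "a \<in> pts" using a by (blast intro: ptsI)
  have c'P: "c' \<in> pts" using c c' by (blast intro: ptsI)
  show False
  proof (cases "a' \<in> vec.span {a}")
    \<comment> \<open>Here \<open>T\<close>, \<open>T'\<close> and \<open>K\<close> pass through one
      point, and \<open>M\<close>, meeting both \<open>T\<close> and \<open>T'\<close>, must pass
      through it as well.\<close>
    case True
    then have "a' \<in> T" using span_subset_line[OF a(1,3)] by blast
    then have "a' \<in> M" using concurrent[OF a(1) a'(1) c(1) ne _ a'(3,2) c(3,4,2) c'(2,3,1)] by blast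
    then show False using nK a' by blast
  next
    \<comment> \<open>Here \<open>a\<close>, \<open>c\<close>, \<open>c'\<close>, \<open>a'\<close>
      is a proper quadrangle. Both \<open>a'\<close> and \<open>c\<close> are collinear with the
      opposite vertices \<open>a\<close> and \<open>c'\<close>, so \<open>pl a\<close> and
      \<open>pl c'\<close> share a line, contrary to \<open>dim_pl_Int\<close>.\<close>
    case False
    have ind: "c' \<notin> vec.span {c}"
    proof
      assume "c' \<in> vec.span {c}"
      then have "c' \<in> T" using span_subset_line[OF a(1) c(4)] by blast
      then have "c' \<in> K" using concurrent[OF a(1) a'(1) K ne _ c'(3,1) a(4,3,2) a'(4,3,2)] by blast
      then show False using nK c' by blast
    qed
    have ca: "c \<in> pl a" using a c by (auto simp: mem_pl)
    have c'n: "c' \<notin> pl a"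
      using line_in_pl[OF aP c(1,3) c'(2) ca _ c(2) ind] naM by blast
    have "a' \<in> pl a" "a' \<in> pl c'" "c \<in> pl c'" using K a a' c c' by (auto simp: mem_pl)
    then have sub: "vec.span {a', c} \<subseteq> pl a \<inter> pl c'"
      using ca pl_subspace[OF aP] pl_subspace[OF c'P] by (intro vec.span_minimal vec.subspace_inter) auto
    have "c \<notin> vec.span {a'}" using span_subset_line[OF K a'(4)] nK c by blast
    then have "vec.dim (vec.span {a', c}) = 2" using a' by (intro dim_span2)
    then show False using vec.dim_subset[OF sub] dim_pl_Int[OF aP c'P c'n] by simp
  qed
qed

lemma card_star_Diff:
  assumes K: "K \<in> \<L>" and T: "T \<in> star K" "T \<noteq> K"
  shows "card (star T - star K) = q^2"
proof -
  obtain a where a: "T \<in> \<L>" "a \<noteq> 0" "a \<in> T" "a \<in> K" using T(1) by (rule starE)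
  have "star T \<inter> star K = thru a" using star_Int_star[OF a(1) K T(2) a(2-4)] .
  moreover have "a \<in> pts" using a by (blast intro: ptsI)
  ultimately show ?thesis
    using card_star[OF a(1)] card_thru[of a] by (simp add: card_Diff_subset_Int)
qed

text \<open>Besides the \<open>q^2 + q + 1\<close> lines of \<open>star K\<close>, each of the
  \<open>q^2 + q\<close> lines \<open>T \<noteq> K\<close> in \<open>star K\<close> contributes
  \<open>q^2\<close> new lines; by \<open>star_disjoint\<close> no new line is contributed
  twice.\<close>

lemma card_near:
  assumes K: "K \<in> \<L>"
  shows "card (near K) = q^4 + q^3 + q^2 + q + 1"
proof -
  let ?N = "star K - {K}"
  have e: "near K = star K \<union> (\<Union>T\<in>?N. star T - star K)"
    unfolding near_def using star_self[OF K] by blast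
  have "card (\<Union>T\<in>?N. star T - star K) = (\<Sum>T\<in>?N. card (star T - star K))"
    using star_disjoint[OF K] by (intro card_UN_disjoint) (simp_all, blast)
  also have "\<dots> = (\<Sum>T\<in>?N. q^2)"
    by (intro sum.cong refl card_star_Diff[OF K]) auto
  also have "\<dots> = (q^2 + q) * q^2" using card_star[OF K] star_self[OF K] by simp
  finally have "card (\<Union>T\<in>?N. star T - star K) = (q^2 + q) * q^2" .
  moreover have "card (near K) = card (star K) + card (\<Union>T\<in>?N. star T - star K)"
    unfolding e by (rule card_Un_disjoint) auto
  ultimately show ?thesis using card_star[OF K] by (simp add: power_numeral_reduce algebra_simps)
qed

section \<open>The solid spanned by two far lines\<close>

lemma far_Int:
  assumes K: "K \<in> \<L>" and M: "M \<in> \<L>" "M \<notin> near K"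
  shows "K \<inter> M = {0}"
proof -
  have "M \<notin> star K" using M star_subset_near[OF K] by blast
  then have "v = 0" if "v \<in> K" "v \<in> M" for v using that M by (auto simp: star_def meets_def)
  then show ?thesis using vec.subspace_0 line_subspace K M by blast
qed

text \<open>The two lines \<open>K\<close> and \<open>M\<close> in the solid force at least
  \<open>q + 1\<close> by (Sd). The last claim allows far lines to be grouped by the solids they
  span with \<open>K\<close>, at least \<open>q\<close> lines in each group.\<close>

lemma far_solid:
  assumes K: "K \<in> \<L>" and M: "M \<in> \<L>" "M \<notin> near K"
  shows "vec.subspace (ssum K M)" and "vec.dim (ssum K M) = 4" and "q + 1 \<le> card (lin (ssum K M))"
    and "\<And>M'. M' \<in> lin (ssum K M) \<Longrightarrow> M' \<noteq> K \<Longrightarrow> M' \<notin> near K"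
proof -
  let ?S = "ssum K M"
  note sK = line_subspace[OF K] line_dim[OF K] and sM = line_subspace[OF M(1)] line_dim[OF M(1)]
  show S: "vec.subspace ?S" using sK sM by (simp add: subspace_ssum)
  have U: "K \<subseteq> ?S" "M \<subseteq> ?S" using sK sM by (simp_all add: ssum_upper1 ssum_upper2)
  show d: "vec.dim ?S = 4" using dim_ssum[OF sK(1) sM(1)] far_Int[OF K M] sK sM by simp
  have "K \<noteq> M" using M star_self[OF K] star_subset_near[OF K] by blast
  then show "q + 1 \<le> card (lin ?S)"
    using card_lin_solid(2)[OF S d, of K M] K M U by (simp add: lin_def)
  \<comment> \<open>If \<open>M'\<close> met \<open>K\<close> in \<open>a\<close>, then
    \<open>pl a\<close> would lie in the solid. The line \<open>M\<close> would meet this plane in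
    some \<open>c\<close>, and the line of the pencil through \<open>c\<close> would make
    \<open>M\<close> near to \<open>K\<close>.\<close>
  have *: "M' \<notin> star K" if M': "M' \<in> lin ?S" "M' \<noteq> K" for M'
  proof
    assume "M' \<in> star K"
    then obtain a where a: "M' \<in> \<L>" "a \<noteq> 0" "a \<in> M'" "a \<in> K" by (rule starE)
    have aP: "a \<in> pts" using a by (blast intro: ptsI)
    note p = pl_subspace[OF aP] pl_dim[OF aP]
    have "ssum K M' \<subseteq> pl a" using line_subset_pl a K p by (intro ssum_least) auto
    moreover have "vec.dim (ssum K M') = 3" using dim_line_sum[OF K a(1) _ a(4,3,2)] M'(2) by blast
    ultimately have "ssum K M' = pl a"
      using p sK(1) line_subspace[OF a(1)] by (intro subspace_eqI) (auto simp: subspace_ssum)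
    moreover have "ssum K M' \<subseteq> ?S" using S U linD(2)[OF M'(1)] by (intro ssum_least)
    ultimately have "pl a \<subseteq> ?S" by simp
    then have "0 < vec.dim (M \<inter> pl a)"
      using dim_Int_ge[OF sM(1) p(1) S U(2)] d p(2) sM(2) by simp
    then obtain c where c: "c \<noteq> 0" "c \<in> M" "c \<in> pl a"
      using subspace_nonzero[OF vec.subspace_inter[OF sM(1) p(1)]] by blast
    then obtain T where "T \<in> \<L>" "a \<in> T" "c \<in> T" by (auto simp: mem_pl)
    then have "M \<in> near K" using a c M by (blast intro: nearI starI)
    then show False using M by blast
  qed
  show "M' \<notin> near K" if M': "M' \<in> lin ?S" "M' \<noteq> K" for M'
  proof
    \<comment> \<open>A line \<open>T\<close> joining \<open>K\<close> to \<open>M'\<close> has two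
      points in the solid, hence lies in it. As \<open>T\<close> meets \<open>K\<close> and differs
      from \<open>K\<close>, this contradicts the previous step.\<close>
    assume "M' \<in> near K"
    then obtain T where T: "T \<in> star K" "M' \<in> star T" by (auto simp: near_def)
    obtain a where a: "T \<in> \<L>" "a \<noteq> 0" "a \<in> T" "a \<in> K" using T(1) by (rule starE)
    obtain c where c: "M' \<in> \<L>" "c \<noteq> 0" "c \<in> M'" "c \<in> T" using T(2) by (rule starE)
    have n: "M' \<notin> star K" using *[OF M'] .
    then have cK: "c \<notin> K" using c by (blast intro: starI)
    then have "c \<notin> vec.span {a}" using span_subset_line[OF K a(4)] by blast
    then have "T = vec.span {a, c}"
      using a c by (intro dim2_eq_span) (auto simp: line_subspace line_dim)
    moreover have "a \<in> ?S" "c \<in> ?S" using a c U linD(2)[OF M'(1)] by auto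
    ultimately have "T \<subseteq> ?S" using S by (simp add: vec.span_minimal)
    then have "T \<in> lin ?S" using a by (simp add: lin_def)
    then show False using *[of T] T cK c by blast
  qed
qed

text \<open>Two lines through \<open>c\<close> inside \<open>H\<close> would span the plane of the
  pencil at \<open>c\<close>, so \<open>H\<close> would contain \<open>T\<close> too.\<close>

lemma unique_line_in:
  assumes H: "vec.subspace H" and T: "T \<in> \<L>" "\<not> T \<subseteq> H" and c: "c \<noteq> 0" "c \<in> T"
    and M: "M \<in> lin H" "c \<in> M" and M': "M' \<in> lin H" "c \<in> M'"
  shows "M = M'"
proof (rule ccontr)
  assume ne: "M \<noteq> M'"
  have L: "M \<in> \<L>" "M \<subseteq> H" "M' \<in> \<L>" "M' \<subseteq> H" using linD M M' by blast+
  have "c \<in> pts" using T c by (blast intro: ptsI)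
  then have "thru c = lin (ssum M M')" using L M M' ne by (intro thru_eq_lin) (auto simp: thru_def)
  moreover have "T \<in> thru c" using T c by (simp add: thru_def)
  ultimately have "T \<subseteq> ssum M M'" by (simp add: lin_def)
  moreover have "ssum M M' \<subseteq> H" using H L by (intro ssum_least)
  ultimately show False using T by blast
qed

text \<open>The hyperplanes of \<open>U\<close> through \<open>C\<close> are averaged over the vectors of \<open>U - C\<close> generating them
  together with \<open>C\<close>; every hyperplane of the pencil arises equally often.\<close>

lemma ex_rich_hyperplane:
  assumes U: "vec.subspace U" "\<Union>\<L> \<subseteq> U" and C: "vec.subspace C" "C \<subseteq> U" "vec.dim C + 2 = vec.dim U"
  obtains H where "vec.subspace H" "C \<subseteq> H" "H \<subseteq> U" "vec.dim H + 1 = vec.dim U"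
    "card (pts \<inter> C) \<le> (q - 1) * card (lin H)"
proof -
  let ?h = "\<lambda>d. ssum C (vec.span {d})" and ?Q = "card C"
  have h: "vec.subspace (?h d)" "C \<subseteq> ?h d" "?h d \<subseteq> U" "vec.dim (?h d) = vec.dim C + 1" if "d \<in> U - C" for d
  proof -
    have "vec.span {d} \<subseteq> U" using that U by (simp add: span_subset_subspace)
    then show "?h d \<subseteq> U" using U C by (intro ssum_least)
    show "vec.dim (?h d) = vec.dim C + 1" using that C by (intro ssum_span_dim) auto
  qed (use C in \<open>auto intro: subspace_ssum ssum_upper1[THEN subsetD]\<close>)
  have cU: "card (U - C) = ?Q * (q^2 - 1)"
  proof -
    have "card U = ?Q * q^2" using card_sub[OF U(1)] card_sub[OF C(1)] C(3)[symmetric] by (simp add: power_add power2_eq_square)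
    then show ?thesis using C(2) by (simp add: card_Diff_subset diff_mult_distrib2)
  qed
  \<comment> \<open>A line inside \<open>C\<close> lies in every hyperplane of the pencil, generated
    by all \<open>?Q * (q^2 - 1)\<close> vectors of \<open>U - C\<close>. A line meeting
    \<open>C\<close> in one point lies in the hyperplane \<open>ssum C M\<close>, generated by
    \<open>?Q * (q - 1)\<close> vectors. For a line missing \<open>C\<close> the left side is
    0.\<close>
  have count: "?Q * card (M \<inter> C - {0}) \<le> card {d \<in> U - C. M \<subseteq> ?h d}" if M: "M \<in> \<L>" for M
  proof (cases "M \<subseteq> C")
    case True
    then have "{d \<in> U - C. M \<subseteq> ?h d} = U - C" using h(2) by blast
    moreover have "card (M \<inter> C - {0}) = q^2 - 1"
      using True line_card[OF M] vec.subspace_0[OF line_subspace[OF M]] by (simp add: Int_absorb2)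
    ultimately show ?thesis using cU by simp
  next
    case False
    note sM = line_subspace[OF M]
    have sI: "vec.subspace (M \<inter> C)" using sM C by (simp add: vec.subspace_inter)
    have d: "vec.dim (M \<inter> C) < 2" using dim_Int_less[OF sM C(1) False] line_dim[OF M] by simp
    show ?thesis
    proof (cases "vec.dim (M \<inter> C) = 0")
      case True
      then have "M \<inter> C = {0}" using dim_0_iff[OF sI] by blast
      then show ?thesis by simp
    next
      case F: False
      then have d1: "vec.dim (M \<inter> C) = 1" using d by linarith
      let ?H = "ssum C M"
      have "M \<subseteq> U" using U M by blast
      then have H: "vec.subspace ?H" "C \<subseteq> ?H" "M \<subseteq> ?H" "?H \<subseteq> U"
        using C sM U by (simp_all add: subspace_ssum ssum_upper1 ssum_upper2 ssum_least)
      have dH: "vec.dim ?H = vec.dim C + 1" using dim_ssum[OF C(1) sM] d1 line_dim[OF M] by (simp add: Int_commute)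
      have "?h d = ?H" if "d \<in> ?H - C" for d
      proof (rule subspace_eqI)
        have dU: "d \<in> U - C" using that H by blast
        show "vec.subspace (?h d)" using h(1)[OF dU] .
        show "?h d \<subseteq> ?H" using that H by (intro ssum_least span_subset_subspace) auto
        show "vec.dim ?H \<le> vec.dim (?h d)" using dH h(4)[OF dU] by simp
      qed (rule H)
      then have "?H - C \<subseteq> {d \<in> U - C. M \<subseteq> ?h d}" using H by auto
      then have "card (?H - C) \<le> card {d \<in> U - C. M \<subseteq> ?h d}" by (intro card_mono) auto
      moreover have "card ?H = ?Q * q" using card_sub[OF H(1)] card_sub[OF C(1)] dH by simp
      then have "card (?H - C) = ?Q * (q - 1)" using H(2) by (simp add: card_Diff_subset diff_mult_distrib2)
      moreover have "card (M \<inter> C - {0}) = q - 1"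
        using card_sub[OF sI] d1 vec.subspace_0[OF sI] by simp
      ultimately show ?thesis by simp
    qed
  qed
  have sum1: "(\<Sum>d\<in>U - C. card (lin (?h d))) = (\<Sum>M\<in>\<L>. card {d \<in> U - C. M \<subseteq> ?h d})"
    unfolding lin_def by (rule sum_multicount_gen) auto
  have "(\<Sum>v\<in>pts \<inter> C. card {M \<in> \<L>. v \<in> M}) = (\<Sum>M\<in>\<L>. card {v \<in> pts \<inter> C. v \<in> M})"
    by (rule sum_multicount_gen) auto
  moreover have "{v \<in> pts \<inter> C. v \<in> M} = M \<inter> C - {0}" if "M \<in> \<L>" for M
    using that by (auto simp: pts_def thru_def)
  moreover have "card {M \<in> \<L>. v \<in> M} = q + 1" if "v \<in> pts \<inter> C" for v
    using card_thru[of v] that by (simp add: thru_def)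
  ultimately have sum2: "card (pts \<inter> C) * (q + 1) = (\<Sum>M\<in>\<L>. card (M \<inter> C - {0}))" by simp
  have "?Q * (card (pts \<inter> C) * (q + 1)) \<le> (\<Sum>d\<in>U - C. card (lin (?h d)))"
    unfolding sum1 sum2 sum_distrib_left using count by (intro sum_mono)
  then have le: "(q - 1) * (?Q * (card (pts \<inter> C) * (q + 1))) \<le> (\<Sum>d\<in>U - C. (q - 1) * card (lin (?h d)))"
    unfolding sum_distrib_left[symmetric] by (rule mult_le_mono2)
  \<comment> \<open>If every hyperplane were poorer, summing over the \<open>?Q * (q^2 - 1)\<close>
    vectors of \<open>U - C\<close> would undercut \<open>le\<close>, because
    \<open>q^2 - 1 = (q - 1) * (q + 1)\<close>.\<close>
  have "\<exists>d\<in>U - C. card (pts \<inter> C) \<le> (q - 1) * card (lin (?h d))"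
  proof (rule ccontr)
    assume neg: "\<not> ?thesis"
    have "0 < ?Q" using vec.subspace_0[OF C(1)] by (auto simp: card_gt_0_iff)
    moreover have "1 < q^2" using one_less_power[OF q_gt_1] by simp
    ultimately have "0 < card (U - C)" using cU by simp
    then have "U - C \<noteq> {}" by (metis card.empty less_irrefl)
    then have "(\<Sum>d\<in>U - C. (q - 1) * card (lin (?h d))) < (\<Sum>d\<in>U - C. card (pts \<inter> C))"
      using neg by (intro sum_strict_mono) (auto simp: not_le)
    also have "\<dots> = ?Q * (q^2 - 1) * card (pts \<inter> C)" using cU by simp
    also have "\<dots> = (q - 1) * (?Q * (card (pts \<inter> C) * (q + 1)))"
    proof -
      have "q^2 - 1 = (q - 1) * (q + 1)" by (simp add: power2_eq_square algebra_simps)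
      then show ?thesis by (simp only: ac_simps)
    qed
    finally show False using le by linarith
  qed
  then obtain d where d: "d \<in> U - C" "card (pts \<inter> C) \<le> (q - 1) * card (lin (?h d))" by blast
  show ?thesis using that[of "?h d"] h[OF d(1)] d(2) C(3) by simp
qed

section \<open>Partition of a pencil plane, and a line meeting a plane inside a solid\<close>

lemma pl_split:
  assumes z: "z \<in> pts"
  shows "pl z = {0} \<union> (vec.span {z} - {0}) \<union> (\<Union>K\<in>thru z. K - vec.span {z})"
proof -
  have "vec.span {z} \<subseteq> pl z" using z pl_self pl_subspace by (simp add: span_subset_subspace)
  then show ?thesis using vec.span_zero[of "{z}"] by (auto simp: pl_def)
qed

lemma thru_disjoint:
  assumes z: "z \<in> pts" and "K \<in> thru z" "K' \<in> thru z" "K \<noteq> K'"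
  shows "(K - vec.span {z}) \<inter> (K' - vec.span {z}) = {}"
  using lines_Int[of K K' z] assms pts_nonzero[OF z] thruD by blast

lemma line_not_in:
  assumes "v \<in> K" "K \<in> \<L>" "v \<notin> vec.span {u}"
  shows "vec.span {v} - {0} \<subseteq> K - vec.span {u}"
proof
  fix s assume s: "s \<in> vec.span {v} - {0}"
  have "s \<notin> vec.span {u}"
  proof
    assume "s \<in> vec.span {u}"
    then have "vec.span {s} \<subseteq> vec.span {u}" by (simp add: span_subset_subspace)
    moreover have "v \<in> vec.span {s}" using s span1_commute[of s v] by blast
    ultimately show False using assms by blast
  qed
  then show "s \<in> K - vec.span {u}" using s span_subset_line[OF assms(2,1)] by blast
qed

lemma card_span_nonzero: "v \<noteq> 0 \<Longrightarrow> card (vec.span {v :: 'a ^ 'n} - {0}) = q - 1"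
  using card_span1[of v] q_def by (simp add: vec.span_zero)

text \<open>In a solid, \<open>M\<close> meets the plane spanned by \<open>K\<close> and
  \<open>z\<close>. It is not contained in that plane, since two lines of a plane intersect while
  \<open>M\<close> misses \<open>K\<close>; so exactly one point is common.\<close>

lemma card_line_Int_plane:
  assumes K: "K \<in> \<L>" and M: "M \<in> \<L>" and MK: "M \<inter> K = {0}" and z: "z \<notin> K"
    and S: "vec.subspace S" "vec.dim S = 4" "M \<subseteq> S" "K \<subseteq> S" "z \<in> S"
  shows "card (M \<inter> ssum K (vec.span {z}) - {0}) = q - 1"
proof -
  let ?p = "ssum K (vec.span {z})"
  note sK = line_subspace[OF K] line_dim[OF K] and sM = line_subspace[OF M] line_dim[OF M]
  have p: "vec.subspace ?p" "vec.dim ?p = 3" "K \<subseteq> ?p"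
    using ssum_span_dim[OF sK(1) z] sK by (simp_all add: subspace_ssum ssum_upper1)
  have pS: "?p \<subseteq> S" using S by (intro ssum_least span_subset_subspace)
  have "\<not> M \<subseteq> ?p"
  proof
    assume "M \<subseteq> ?p"
    then have "0 < vec.dim (M \<inter> K)" using dim_Int_ge[OF sM(1) sK(1) p(1) _ p(3)] sM sK p(2) by simp
    then show False unfolding MK by simp
  qed
  then have "vec.dim (M \<inter> ?p) < 2" using dim_Int_less[OF sM(1) p(1)] sM(2) by simp
  moreover have "1 \<le> vec.dim (M \<inter> ?p)" using dim_Int_ge[OF sM(1) p(1) S(1,3) pS] sM p S by simp
  ultimately have "vec.dim (M \<inter> ?p) = 1" by linarith
  moreover have sI: "vec.subspace (M \<inter> ?p)" using sM p by (simp add: vec.subspace_inter)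
  ultimately show ?thesis using card_sub[OF sI] vec.subspace_0[OF sI] by simp
qed

end

section \<open>Lines in a hyperplane\<close>

text \<open>Hyperplanes are taken relative to a space \<open>U\<close> containing all lines; it will
  be the span of the lines.\<close>

locale line_set_hyperplane = line_set \<L> q
  for \<L> :: "('a::{field,finite} ^ 'n) set set" and q :: nat +
  fixes U H :: "('a ^ 'n) set"
  assumes U: "vec.subspace U" "\<Union>\<L> \<subseteq> U"
    and H: "vec.subspace H" "H \<subseteq> U" "vec.dim H + 1 = vec.dim U"
begin

lemma line_sub_U: "M \<in> \<L> \<Longrightarrow> M \<subseteq> U"
  using U by blast

lemma dim_Int_H: "vec.subspace S \<Longrightarrow> S \<subseteq> U \<Longrightarrow> vec.dim S \<le> vec.dim (S \<inter> H) + 1"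
  using dim_Int_ge[OF _ H(1) U(1) _ H(2), of S] H(3) by simp

lemma line_Int_H:
  assumes T: "T \<in> \<L>" "\<not> T \<subseteq> H"
  obtains b where "b \<noteq> 0" "b \<in> T" "b \<in> H" "T \<inter> H = vec.span {b}"
proof -
  note s = line_subspace[OF T(1)]
  have "vec.dim (T \<inter> H) < 2" using dim_Int_less[OF s H(1) T(2)] line_dim[OF T(1)] by simp
  moreover have "0 < vec.dim (T \<inter> H)" using dim_Int_H[OF s line_sub_U[OF T(1)]] line_dim[OF T(1)] by simp
  ultimately have d: "vec.dim (T \<inter> H) \<le> 1" "0 < vec.dim (T \<inter> H)" by auto
  have i: "vec.subspace (T \<inter> H)" using s H by (simp add: vec.subspace_inter)
  obtain b where b: "b \<noteq> 0" "b \<in> T \<inter> H" using subspace_nonzero[OF i d(2)] by blast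
  show ?thesis using that[of b] dim1_eq_span[OF i d(1) b(2,1)] b by blast
qed

lemma mem_line_Int_H:
  assumes "M \<in> \<L>" "v \<noteq> 0" "v \<in> M" "v \<in> T" "v \<in> H" "T \<inter> H = vec.span {b}"
  shows "b \<in> M"
proof -
  have "v \<in> vec.span {b}" using assms(4-6) by blast
  from span1_commute[OF assms(2) this] show ?thesis using span_subset_line[OF assms(1,3)] by blast
qed

text \<open>A line of \<open>H\<close> can meet \<open>T\<close> only in the single point
  \<open>T \<inter> H\<close>, and \<open>unique_line_in\<close> leaves at most one line of
  \<open>H\<close> there.\<close>

lemma card_lin_star:
  assumes T: "T \<in> \<L>" "\<not> T \<subseteq> H"
  shows "card (lin H \<inter> star T) \<le> 1"
proof (rule card_le_1I)
  obtain b where b: "b \<noteq> 0" "b \<in> T" "b \<in> H" "T \<inter> H = vec.span {b}" using line_Int_H[OF T] .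
  have *: "b \<in> M" if M: "M \<in> lin H \<inter> star T" for M
  proof -
    have "M \<in> star T" using M by blast
    then obtain v where "M \<in> \<L>" "v \<noteq> 0" "v \<in> M" "v \<in> T" by (rule starE)
    then show ?thesis using mem_line_Int_H[of M v T b] M b(4) linD(2)[of M H] by blast
  qed
  show "M = M'" if "M \<in> lin H \<inter> star T" "M' \<in> lin H \<inter> star T" for M M'
    using unique_line_in[OF H(1) T b(1,2), of M M'] *[OF that(1)] *[OF that(2)] that by blast
qed simp

text \<open>Let \<open>T\<close> join \<open>K\<close> to a line \<open>M\<close> of
  \<open>H\<close>, and let \<open>b\<close> be the point \<open>K \<inter> H\<close>. At most one
  \<open>M\<close> meets \<open>K\<close> itself. If \<open>T\<close> lies in \<open>H\<close>, it
  is unique and yields at most \<open>q^2\<close> lines. The \<open>q^2\<close> lines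
  \<open>T\<close> of \<open>star K\<close> not through \<open>b\<close> lie outside
  \<open>H\<close> and yield at most one line each.\<close>

lemma card_lin_near:
  assumes K: "K \<in> \<L>" "\<not> K \<subseteq> H"
  shows "card (lin H \<inter> near K) \<le> 1 + 2 * q^2"
proof -
  obtain b where b: "b \<noteq> 0" "b \<in> K" "b \<in> H" "K \<inter> H = vec.span {b}" using line_Int_H[OF K] .
  have bP: "b \<in> pts" using b K by (blast intro: ptsI)
  let ?A = "lin H \<inter> star K" and ?B = "\<Union>T\<in>lin H \<inter> star K. star T - star K"
    and ?C = "\<Union>T\<in>star K - thru b. lin H \<inter> star T"
  have "lin H \<inter> near K \<subseteq> ?A \<union> ?B \<union> ?C"
  proof
    fix M assume M: "M \<in> lin H \<inter> near K"
    then obtain T where T: "T \<in> star K" "M \<in> star T" by (auto simp: near_def)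
    have TL: "T \<in> \<L>" using T(1) by (rule starE)
    obtain c where c: "M \<in> \<L>" "c \<noteq> 0" "c \<in> M" "c \<in> T" using T(2) by (rule starE)
    have cH: "c \<in> H" using c(3) M linD(2)[of M H] by blast
    consider "M \<in> star K" | "T \<in> lin H" "M \<notin> star K" | "\<not> T \<subseteq> H" "T \<in> thru b" | "T \<notin> thru b"
      using TL by (auto simp: lin_def)
    then show "M \<in> ?A \<union> ?B \<union> ?C"
    proof cases
      \<comment> \<open>Here \<open>T\<close> and \<open>K\<close> meet \<open>H\<close> in the same
        point. As \<open>M\<close> lies in \<open>H\<close> and meets \<open>T\<close>, it passes
        through that point and so meets \<open>K\<close>.\<close>
      case 3
      then have bT: "b \<in> T" by (simp add: thru_def)
      obtain b' where b': "b' \<noteq> 0" "b' \<in> T" "b' \<in> H" "T \<inter> H = vec.span {b'}" using line_Int_H[OF TL 3(1)] .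
      have "b \<in> vec.span {b'}" using b(3) b'(4) bT by blast
      from span1_commute[OF b(1) this] have "b' \<in> K" using b(4) by blast
      moreover have "b' \<in> M" using mem_line_Int_H[OF c(1,2,3,4) cH b'(4)] .
      ultimately have "M \<in> star K" using starI[OF c(1) b'(1)] by blast
      then show ?thesis using M by blast
    next
      case 1
      then show ?thesis using M by blast
    next
      case 2
      then have "M \<in> ?B" using T by blast
      then show ?thesis by blast
    next
      case 4
      then have "M \<in> ?C" using T M by blast
      then show ?thesis by blast
    qed
  qed
  then have "card (lin H \<inter> near K) \<le> card (?A \<union> ?B \<union> ?C)" by (intro card_mono) auto
  also have "\<dots> \<le> card ?A + card ?B + card ?C"
    using card_Un_le[of "?A \<union> ?B" ?C] card_Un_le[of ?A ?B] by linarith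
  also have "\<dots> \<le> 1 + q^2 + q^2"
  proof (intro add_mono)
    show A: "card ?A \<le> 1" using K by (rule card_lin_star)
    have "card ?B \<le> (\<Sum>T\<in>?A. card (star T - star K))" by (rule card_UN_le) simp
    also have "\<dots> = (\<Sum>T\<in>?A. q^2)"
      using K by (intro sum.cong refl card_star_Diff) (auto simp: lin_def)
    also have "\<dots> \<le> 1 * q^2" using mult_right_mono[OF A, of "q^2"] by simp
    finally show "card ?B \<le> q^2" by simp
    have "card ?C \<le> (\<Sum>T\<in>star K - thru b. card (lin H \<inter> star T))" by (rule card_UN_le) simp
    also have "\<dots> \<le> (\<Sum>T\<in>star K - thru b. 1)"
    proof (intro sum_mono)
      fix T assume "T \<in> star K - thru b"
      then have T: "T \<in> star K" "T \<notin> thru b" by auto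
      obtain v where v: "T \<in> \<L>" "v \<noteq> 0" "v \<in> T" "v \<in> K" using T(1) by (rule starE)
      have "\<not> T \<subseteq> H"
      proof
        assume "T \<subseteq> H"
        then have "b \<in> T" using mem_line_Int_H[OF v(1,2,3,4) _ b(4)] v by blast
        then show False using T v by (simp add: thru_def)
      qed
      then show "card (lin H \<inter> star T) \<le> 1" using v by (intro card_lin_star)
    qed
    also have "\<dots> = card (star K - thru b)" by simp
    also have "\<dots> = q^2"
    proof -
      have "thru b \<subseteq> star K" using b by (auto simp: thru_def intro: starI)
      then show ?thesis using card_star[OF K(1)] card_thru[OF bP] by (simp add: card_Diff_subset)
    qed
    finally show "card ?C \<le> q^2" .
  qed
  finally show ?thesis by simp
qed

text \<open>If different, \<open>M\<close> and \<open>M'\<close> would lie in the plane where the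
  common solid meets \<open>H\<close>, hence intersect in a point \<open>c\<close>, and that plane
  would be \<open>pl c\<close>. It also contains the point \<open>b\<close> of \<open>K\<close> in
  \<open>H\<close>; the line of \<open>\<L>\<close> joining \<open>c\<close> and \<open>b\<close>
  would make \<open>M\<close> near to \<open>K\<close>.\<close>

lemma far_lines_in_H:
  assumes K: "K \<in> \<L>" "\<not> K \<subseteq> H"
    and M: "M \<in> lin H" "M \<notin> near K" and M': "M' \<in> lin H" "M' \<notin> near K"
    and e: "ssum K M = ssum K M'"
  shows "M = M'"
proof (rule ccontr)
  assume ne: "M \<noteq> M'"
  obtain b where b: "b \<noteq> 0" "b \<in> K" "b \<in> H" "K \<inter> H = vec.span {b}" using line_Int_H[OF K] .
  have L: "M \<in> \<L>" "M \<subseteq> H" "M' \<in> \<L>" "M' \<subseteq> H" using linD M M' by blast+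
  let ?S = "ssum K M"
  have S: "vec.subspace ?S" "vec.dim ?S = 4" using far_solid[OF K(1) L(1) M(2)] by auto
  have U': "K \<subseteq> ?S" "M \<subseteq> ?S" using line_subspace K(1) L(1) by (simp_all add: ssum_upper1 ssum_upper2)
  have U'': "M' \<subseteq> ?S" unfolding e using line_subspace K(1) L(3) by (simp add: ssum_upper2)
  let ?p = "?S \<inter> H"
  have sp: "vec.subspace ?p" using S H by (simp add: vec.subspace_inter)
  have "\<not> ?S \<subseteq> H" using U' K by blast
  then have dp: "vec.dim ?p \<le> 3" using dim_Int_less[OF S(1) H(1)] S by simp
  have "0 < vec.dim (M \<inter> M')"
    using dim_Int_ge[OF line_subspace[OF L(1)] line_subspace[OF L(3)] sp] U' U'' L dp line_dim by simp
  then obtain c where c: "c \<noteq> 0" "c \<in> M" "c \<in> M'"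
    using subspace_nonzero[OF vec.subspace_inter[OF line_subspace[OF L(1)] line_subspace[OF L(3)]]] by blast
  have cP: "c \<in> pts" using c L by (blast intro: ptsI)
  have d: "vec.dim (ssum M M') = 3" using dim_line_sum[OF L(1,3) ne c(2,3,1)] .
  have s: "vec.subspace (ssum M M')" using line_subspace L by (simp add: subspace_ssum)
  have "ssum M M' \<subseteq> ?p" using sp U' U'' L by (intro ssum_least) auto
  then have 1: "ssum M M' = ?p" using s sp d dp by (intro subspace_eqI) auto
  have "ssum M M' \<subseteq> pl c" using c L pl_subspace[OF cP] by (intro ssum_least line_subset_pl)
  then have 2: "ssum M M' = pl c" using s d pl_subspace[OF cP] pl_dim[OF cP] by (intro subspace_eqI) auto
  have "b \<in> ?p" using b U' by blast
  then have "b \<in> pl c" using 1 2 by simp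
  then obtain T where "T \<in> \<L>" "c \<in> T" "b \<in> T" by (auto simp: mem_pl)
  then have "M \<in> near K" using b c L by (blast intro: nearI starI)
  then show False using M by blast
qed

text \<open>Each far line of \<open>H\<close> has its own solid through \<open>K\<close> with at
  least \<open>q\<close> far lines, so \<open>q\<close> times the number of far lines of
  \<open>H\<close> is at most the number of all far lines, known from \<open>card_near\<close>. The
  near lines of \<open>H\<close> are bounded by \<open>card_lin_near\<close>.\<close>

lemma card_lin_hyperplane:
  assumes K: "K \<in> \<L>" "\<not> K \<subseteq> H"
  shows "q * card (lin H) + (q^4 + q^3 + q^2 + q + 1) \<le> card \<L> + q * (1 + 2 * q^2)"
proof -
  let ?F = "lin H - near K" and ?G = "\<lambda>M. lin (ssum K M) - {K}"
  have FL: "M \<in> \<L>" "M \<notin> near K" if "M \<in> ?F" for M using that linD by blast+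
  have G: "q \<le> card (?G M)" "?G M \<subseteq> \<L> - near K" if "M \<in> ?F" for M
    using far_solid(3,4)[OF K(1) FL[OF that]] linD(1)[of _ "ssum K M"] card_Diff1_le
    by (auto simp: card_Diff_singleton_if)
  \<comment> \<open>Any far line of the solid determines the solid together with \<open>K\<close>;
    thus a line common to \<open>?G M\<close> and \<open>?G M'\<close> makes the two solids equal,
    and \<open>far_lines_in_H\<close> applies.\<close>
  have G': "ssum K N = ssum K M" if M: "M \<in> ?F" and N: "N \<in> ?G M" for M N
  proof -
    have NL: "N \<in> \<L>" "N \<notin> near K" using N linD(1) G(2)[OF M] by blast+
    note f = far_solid(1,2)[OF K(1) NL] far_solid(1,2)[OF K(1) FL[OF M]]
    have "ssum K N \<subseteq> ssum K M"
      using f N linD(2) line_subspace FL[OF M] by (intro ssum_least) (auto intro: ssum_upper1[THEN subsetD])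
    then show ?thesis using f by (intro subspace_eqI) auto
  qed
  have "q * card ?F = (\<Sum>M\<in>?F. q)" by simp
  also have "\<dots> \<le> (\<Sum>M\<in>?F. card (?G M))" using G(1) by (intro sum_mono)
  also have "\<dots> = card (\<Union>M\<in>?F. ?G M)"
  proof (rule card_UN_disjoint[symmetric])
    show "\<forall>M\<in>?F. \<forall>M'\<in>?F. M \<noteq> M' \<longrightarrow> ?G M \<inter> ?G M' = {}"
    proof (intro ballI impI equals0I)
      fix M M' N assume M: "M \<in> ?F" "M' \<in> ?F" "M \<noteq> M'" and "N \<in> ?G M \<inter> ?G M'"
      then have "ssum K M = ssum K M'" using G'[OF M(1), of N] G'[OF M(2), of N] by simp
      then show False using far_lines_in_H[OF K] M by blast
    qed
  qed auto
  also have "\<dots> \<le> card (\<L> - near K)" using G(2) by (intro card_mono) auto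
  finally have 1: "q * card ?F \<le> card (\<L> - near K)" .
  have "near K \<subseteq> \<L>" by (auto simp: near_def star_def)
  then have 2: "card (\<L> - near K) + (q^4 + q^3 + q^2 + q + 1) = card \<L>"
    using card_near[OF K(1)] card_Diff_subset[of "near K" \<L>] card_mono[of \<L> "near K"] by simp
  have "card (lin H) = card ?F + card (lin H \<inter> near K)"
    using card_Un_disjoint[of ?F "lin H \<inter> near K"] Un_Diff_Int[of "lin H" "near K"] by fastforce
  then have "card (lin H) \<le> card ?F + (1 + 2 * q^2)" using card_lin_near[OF K] by simp
  from mult_le_mono2[OF this, of q] have "q * card (lin H) \<le> q * card ?F + q * (1 + 2 * q^2)"
    by (simp only: add_mult_distrib2)
  then show ?thesis using 1 2 by linarith
qed

end

section \<open>Points in the span of two disjoint pencils\<close>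

locale far_points = line_set \<L> q
  for \<L> :: "('a::{field,finite} ^ 'n) set set" and q :: nat +
  fixes x y :: "'a ^ 'n"
  assumes x: "x \<in> pts" and y: "y \<in> pts" and far: "pl x \<inter> pl y = {0}"
begin

abbreviation "sx \<equiv> vec.span {x} - {0}"
abbreviation "sy \<equiv> vec.span {y} - {0}"

text \<open>The arguments will be pieces of \<open>pl x\<close> and \<open>pl y\<close>. As the sum
  of these planes is direct, \<open>np\<close> is additive over partitions of either
  argument.\<close>

definition np :: "('a ^ 'n) set \<Rightarrow> ('a ^ 'n) set \<Rightarrow> nat" where "np A B = card (pts \<inter> ssum A B)"

lemma x0: "x \<noteq> 0" and y0: "y \<noteq> 0"
  using x y pts_nonzero by auto

lemma spanx: "vec.span {x} \<subseteq> pl x" and spany: "vec.span {y} \<subseteq> pl y"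
  using x y pl_self pl_subspace by (simp_all add: span_subset_subspace)

section \<open>Directness of the sum of the two planes and additivity of the count\<close>

lemma decomp_unique:
  assumes "a \<in> pl x" "a' \<in> pl x" "b \<in> pl y" "b' \<in> pl y" "a + b = a' + b'"
  shows "a = a' \<and> b = b'"
proof -
  have e: "a - a' = b' - b" using assms(5) by (simp add: algebra_simps)
  have "a - a' \<in> pl x" using assms x by (simp add: pl_subspace vec.subspace_diff)
  moreover have "a - a' \<in> pl y" unfolding e using assms y by (simp add: pl_subspace vec.subspace_diff)
  ultimately have "a - a' = 0" using far by blast
  then show ?thesis using e by simp
qed

lemma card_ssum_direct:
  assumes "A \<subseteq> pl x" "B \<subseteq> pl y"
  shows "card (ssum A B) = card A * card B"
proof -
  have "ssum A B = (\<lambda>p. fst p + snd p) ` (A \<times> B)" by (force simp: ssum_def)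
  moreover have "inj_on (\<lambda>p. fst p + snd p) (A \<times> B)"
    using assms decomp_unique by (intro inj_onI prod_eqI) (auto, blast+)
  ultimately show ?thesis by (simp add: card_image card_cartesian_product)
qed

lemma ssum_disjoint1:
  assumes "A \<subseteq> pl x" "A' \<subseteq> pl x" "B \<subseteq> pl y" "B' \<subseteq> pl y" "A \<inter> A' = {}"
  shows "ssum A B \<inter> ssum A' B' = {}"
proof (rule equals0I)
  fix v assume "v \<in> ssum A B \<inter> ssum A' B'"
  then obtain a b a' b' where "a \<in> A" "b \<in> B" "a' \<in> A'" "b' \<in> B'" "a + b = a' + b'"
    by (auto simp: ssum_def)
  then show False using decomp_unique[of a a' b b'] assms by blast
qed

lemma ssum_disjoint2:
  assumes "A \<subseteq> pl x" "A' \<subseteq> pl x" "B \<subseteq> pl y" "B' \<subseteq> pl y" "B \<inter> B' = {}"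
  shows "ssum A B \<inter> ssum A' B' = {}"
proof (rule equals0I)
  fix v assume "v \<in> ssum A B \<inter> ssum A' B'"
  then obtain a b a' b' where "a \<in> A" "b \<in> B" "a' \<in> A'" "b' \<in> B'" "a + b = a' + b'"
    by (auto simp: ssum_def)
  then show False using decomp_unique[of a a' b b'] assms by blast
qed

lemma np_split1:
  assumes B: "B \<subseteq> pl y"
  shows "np (pl x) B = np {0} B + np sx B + (\<Sum>K\<in>thru x. np (K - vec.span {x}) B)"
proof -
  have K: "K - vec.span {x} \<subseteq> pl x" if "K \<in> thru x" for K using that by (auto simp: pl_def)
  have s0: "{0} \<subseteq> pl x" "sx \<subseteq> pl x" using spanx vec.subspace_0[OF pl_subspace[OF x]] by auto
  let ?P = "\<lambda>A. pts \<inter> ssum A B" and ?o = "\<lambda>K. K - vec.span {x}"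
  have UN: "card (\<Union>K\<in>thru x. ?P (?o K)) = (\<Sum>K\<in>thru x. np (?o K) B)"
    unfolding np_def
    using ssum_disjoint1[OF K K B B thru_disjoint[OF x]] by (intro card_UN_disjoint) (simp_all, blast)
  have z1: "?P {0} \<inter> ?P sx = {}" using ssum_disjoint1[OF s0 B B] by blast
  have z2: "(?P {0} \<union> ?P sx) \<inter> (\<Union>K\<in>thru x. ?P (?o K)) = {}"
  proof -
    have "?P {0} \<inter> ?P (?o K) = {}" if "K \<in> thru x" for K
      using ssum_disjoint1[OF s0(1) K[OF that] B B] vec.span_zero[of "{x}"] by blast
    moreover have "?P sx \<inter> ?P (?o K) = {}" if "K \<in> thru x" for K
      using ssum_disjoint1[OF s0(2) K[OF that] B B] by blast
    ultimately show ?thesis by blast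
  qed
  have "?P (pl x) = ?P {0} \<union> ?P sx \<union> (\<Union>K\<in>thru x. ?P (?o K))"
    by (subst pl_split[OF x]) (simp only: ssum_Un1 ssum_UN1 Int_Un_distrib Int_UN_distrib)
  then have "np (pl x) B = card (?P {0} \<union> ?P sx \<union> (\<Union>K\<in>thru x. ?P (?o K)))" by (simp add: np_def)
  also have "\<dots> = card (?P {0}) + card (?P sx) + card (\<Union>K\<in>thru x. ?P (?o K))"
    using z1 z2 by (simp add: card_Un_disjoint)
  finally show ?thesis using UN by (simp add: np_def)
qed

lemma np_split2:
  assumes A: "A \<subseteq> pl x"
  shows "np A (pl y) = np A {0} + np A sy + (\<Sum>N\<in>thru y. np A (N - vec.span {y}))"
proof -
  have N: "N - vec.span {y} \<subseteq> pl y" if "N \<in> thru y" for N using that by (auto simp: pl_def)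
  have s0: "{0} \<subseteq> pl y" "sy \<subseteq> pl y" using spany vec.subspace_0[OF pl_subspace[OF y]] by auto
  let ?P = "\<lambda>B. pts \<inter> ssum A B" and ?o = "\<lambda>N. N - vec.span {y}"
  have UN: "card (\<Union>N\<in>thru y. ?P (?o N)) = (\<Sum>N\<in>thru y. np A (?o N))"
    unfolding np_def
    using ssum_disjoint2[OF A A N N thru_disjoint[OF y]] by (intro card_UN_disjoint) (simp_all, blast)
  have z1: "?P {0} \<inter> ?P sy = {}" using ssum_disjoint2[OF A A s0] by blast
  have z2: "(?P {0} \<union> ?P sy) \<inter> (\<Union>N\<in>thru y. ?P (?o N)) = {}"
  proof -
    have "?P {0} \<inter> ?P (?o N) = {}" if "N \<in> thru y" for N
      using ssum_disjoint2[OF A A s0(1) N[OF that]] vec.span_zero[of "{y}"] by blast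
    moreover have "?P sy \<inter> ?P (?o N) = {}" if "N \<in> thru y" for N
      using ssum_disjoint2[OF A A s0(2) N[OF that]] by blast
    ultimately show ?thesis by blast
  qed
  have "?P (pl y) = ?P {0} \<union> ?P sy \<union> (\<Union>N\<in>thru y. ?P (?o N))"
    by (subst pl_split[OF y]) (simp only: ssum_Un2 ssum_UN2 Int_Un_distrib Int_UN_distrib)
  then have "np A (pl y) = card (?P {0} \<union> ?P sy \<union> (\<Union>N\<in>thru y. ?P (?o N)))" by (simp add: np_def)
  also have "\<dots> = card (?P {0}) + card (?P sy) + card (\<Union>N\<in>thru y. ?P (?o N))"
    using z1 z2 by (simp add: card_Un_disjoint)
  finally show ?thesis using UN by (simp add: np_def)
qed

section \<open>The contribution of one line from each pencil\<close>

lemma zero_not_in_ssum: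
  assumes "A \<subseteq> pl x" "B \<subseteq> pl y" "0 \<notin> A"
  shows "0 \<notin> ssum A B"
proof
  assume "0 \<in> ssum A B"
  then obtain a b where ab: "a \<in> A" "b \<in> B" "a + b = 0" by (auto simp: ssum_def)
  then have "a = 0 \<and> b = 0"
    using decomp_unique[of a 0 b 0] assms vec.subspace_0 pl_subspace x y by auto
  then show False using ab assms by blast
qed

text \<open>When both pieces lie in one further pencil plane \<open>pl z\<close>, so does their sum,
  and every nonzero vector of such a plane belongs to \<open>pts\<close>.\<close>

lemma np_ge:
  assumes A: "A \<subseteq> A'" "A' \<subseteq> pl x" "0 \<notin> A" "A \<subseteq> pl z" and B: "B \<subseteq> B'" "B' \<subseteq> pl y" "B \<subseteq> pl z"
    and z: "z \<in> pts"
  shows "card A * card B \<le> np A' B'"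
proof -
  have s: "A \<subseteq> pl x" "B \<subseteq> pl y" using A B by auto
  have "ssum A B \<subseteq> pl z" using A B pl_subspace[OF z] by (intro ssum_least)
  moreover have "0 \<notin> ssum A B" using zero_not_in_ssum[OF s A(3)] .
  ultimately have "ssum A B \<subseteq> pts" using pl_pts by blast
  then have "ssum A B \<subseteq> pts \<inter> ssum A' B'" using ssum_mono[OF A(1) B(1)] by blast
  then have "card (ssum A B) \<le> np A' B'" unfolding np_def by (intro card_mono) auto
  then show ?thesis using card_ssum_direct[OF s] by simp
qed

text \<open>A line \<open>T\<close> joins some \<open>w\<close> on \<open>K\<close> to some
  \<open>w'\<close> on \<open>N\<close>; disjointness of \<open>pl x\<close> and \<open>pl y\<close>
  keeps \<open>w\<close> off the point \<open>x\<close> and \<open>w'\<close> off the point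
  \<open>y\<close>. Since \<open>pl w\<close> contains \<open>K\<close> and \<open>w'\<close>, and
  \<open>pl w'\<close> contains \<open>N\<close> and \<open>w\<close>, \<open>np_ge\<close> applies
  to pieces of these planes.\<close>

lemma solid_count_near:
  assumes K: "K \<in> thru x" and N: "N \<in> thru y" and near: "N \<in> near K"
  shows "(q - 1)^2 \<le> np (K - vec.span {x}) sy" and "(q - 1)^2 \<le> np sx (N - vec.span {y})"
    and "(q - 1)^3 \<le> np (K - vec.span {x}) (N - vec.span {y})"
proof -
  note KL = thruD[OF K] and NL = thruD[OF N]
  have sub: "K \<subseteq> pl x" "N \<subseteq> pl y" using line_subset_pl KL NL by auto
  obtain T where T: "T \<in> star K" "N \<in> star T" using near by (auto simp: near_def)
  obtain w where w: "T \<in> \<L>" "w \<noteq> 0" "w \<in> T" "w \<in> K" using T(1) by (rule starE)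
  obtain w' where w': "w' \<noteq> 0" "w' \<in> N" "w' \<in> T" using T(2) by (rule starE)
  have disj: "v = 0" if "v \<in> pl x" "v \<in> pl y" for v using that far by blast
  have wx: "w \<notin> vec.span {x}"
  proof
    assume "w \<in> vec.span {x}"
    then have "x \<in> T" using span1_commute[OF w(2)] span_subset_line[OF w(1,3)] by blast
    then have "w' \<in> pl x" using w w' by (auto simp: mem_pl)
    then show False using disj w' sub by blast
  qed
  have wy: "w' \<notin> vec.span {y}"
  proof
    assume "w' \<in> vec.span {y}"
    then have "y \<in> T" using span1_commute[OF w'(1)] span_subset_line[OF w(1) w'(3)] by blast
    then have "w \<in> pl y" using w w' by (auto simp: mem_pl)
    then show False using disj w sub by blast
  qed
  have P: "w \<in> pts" "w' \<in> pts" using w w' by (auto intro: ptsI)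
  have in1: "K \<subseteq> pl w" "w' \<in> pl w" "N \<subseteq> pl w'" "w \<in> pl w'"
    using w w' KL NL by (auto simp: mem_pl)
  have sp: "vec.span {w'} - {0} \<subseteq> pl w" "vec.span {w} - {0} \<subseteq> pl w'" "sx \<subseteq> pl w" "sy \<subseteq> pl w'"
    using in1 span_subset_subspace[OF pl_subspace[OF P(1)], of w'] span_subset_subspace[OF pl_subspace[OF P(2)], of w]
      span_subset_line[OF KL] span_subset_line[OF NL] by auto
  have wK: "vec.span {w} - {0} \<subseteq> K - vec.span {x}" and wN: "vec.span {w'} - {0} \<subseteq> N - vec.span {y}"
    using line_not_in w w' wx wy KL NL by auto
  have "card (vec.span {w} - {0}) * card sy \<le> np (K - vec.span {x}) sy"
    by (rule np_ge[where z=w']) (use wK sub sp spany P in auto)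
  then show "(q - 1)^2 \<le> np (K - vec.span {x}) sy"
    using card_span_nonzero w(2) y0 by (simp add: power2_eq_square)
  have "card sx * card (vec.span {w'} - {0}) \<le> np sx (N - vec.span {y})"
    by (rule np_ge[where z=w]) (use wN sub sp spanx P in auto)
  then show "(q - 1)^2 \<le> np sx (N - vec.span {y})"
    using card_span_nonzero w'(1) x0 by (simp add: power2_eq_square)
  have "card (K - vec.span {x}) * card (vec.span {w'} - {0}) \<le> np (K - vec.span {x}) (N - vec.span {y})"
    by (rule np_ge[where z=w]) (use wN sub sp in1 P vec.span_zero[of "{x}"] in auto)
  moreover have "card (K - vec.span {x}) = q^2 - q"
    using line_card[OF KL(1)] card_span1[OF x0] span_subset_line[OF KL] q_def by (simp add: card_Diff_subset)
  \<comment> \<open>The true bound \<open>q * (q - 1)^2\<close> is weakened to the form that also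
    holds for far pairs.\<close>
  moreover have "(q - 1)^3 \<le> (q^2 - q) * (q - 1)"
  proof -
    obtain p where "q = Suc p" using q_gt_1 by (cases q) auto
    then show ?thesis by (simp add: power2_eq_square power3_eq_cube)
  qed
  ultimately show "(q - 1)^3 \<le> np (K - vec.span {x}) (N - vec.span {y})"
    using card_span_nonzero[OF w'(1)] by simp
qed

text \<open>The line \<open>M\<close> has one point in the plane of \<open>K\<close> and
  \<open>y\<close> and one in the plane of \<open>N\<close> and \<open>x\<close>. If these points
  lie on the line joining \<open>x\<close> and \<open>y\<close>, they are one point, counted by
  \<open>t\<close>. Inclusion and exclusion leave \<open>(q^2 - 1) - 2 * (q - 1) + t\<close> vectors
  in general position.\<close>

lemma line_in_solid_count:
  assumes K: "K \<in> thru x" and N: "N \<in> thru y"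
    and M: "M \<in> \<L>" "M \<subseteq> ssum K N" "M \<inter> K = {0}" "M \<inter> N = {0}"
  defines "t \<equiv> card (M \<inter> ssum sx sy)"
  shows "card (M \<inter> ssum (K - vec.span {x}) sy) + t = q - 1"
    and "card (M \<inter> ssum sx (N - vec.span {y})) + t = q - 1"
    and "card (M \<inter> ssum (K - vec.span {x}) (N - vec.span {y})) = (q - 1)^2 + t"
proof -
  note KL = thruD[OF K] and NL = thruD[OF N]
  have sub: "K \<subseteq> pl x" "N \<subseteq> pl y" using line_subset_pl KL NL by auto
  let ?K = "K - vec.span {x}" and ?N = "N - vec.span {y}"
  have sK: "sx \<subseteq> K" "sy \<subseteq> N" "vec.span {x} \<subseteq> K" "vec.span {y} \<subseteq> N"
    using span_subset_line[OF KL] span_subset_line[OF NL] by auto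
  have KN: "K \<inter> N = {0}" using sub far vec.subspace_0 line_subspace KL NL by blast
  have S: "vec.subspace (ssum K N)" "K \<subseteq> ssum K N" "N \<subseteq> ssum K N" "vec.dim (ssum K N) = 4"
    using line_subspace KL NL dim_ssum[of K N] KN
    by (simp_all add: subspace_ssum ssum_upper1 ssum_upper2 line_dim)
  \<comment> \<open>Since \<open>M\<close> misses \<open>K\<close> and \<open>N\<close>, both
    components of a nonzero vector of \<open>M\<close> are nonzero; hence the four sums of pieces
    cover \<open>M - {0}\<close>.\<close>
  have nz: "k \<noteq> 0 \<and> n \<noteq> 0" if "k \<in> K" "n \<in> N" "k + n \<in> M" "k + n \<noteq> 0" for k n
    using that M(3,4) by (metis IntI add.left_neutral add.right_neutral singletonD)
  have z: "0 \<notin> ssum A B" if "A \<subseteq> K" "B \<subseteq> N" "0 \<notin> A" for A B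
    using zero_not_in_ssum[of A B] that sub by blast
  have z4: "0 \<notin> ssum ?K ?N" "0 \<notin> ssum ?K sy" "0 \<notin> ssum sx ?N" "0 \<notin> ssum sx sy"
    using sK(1,2) vec.span_zero[of "{x}"] by (intro z; blast)+
  let ?T = "M \<inter> ssum sx sy" and ?A = "M \<inter> ssum ?K sy" and ?C = "M \<inter> ssum sx ?N" and ?G = "M \<inter> ssum ?K ?N"
  have dj: "ssum A B \<inter> ssum A' B' = {}"
    if "A \<subseteq> K" "A' \<subseteq> K" "B \<subseteq> N" "B' \<subseteq> N" "A \<inter> A' = {} \<or> B \<inter> B' = {}" for A A' B B'
    using that ssum_disjoint1[of A A' B B'] ssum_disjoint2[of A A' B B'] sub by blast
  have AT: "?A \<inter> ?T = {}" using dj[of ?K sx sy sy] sK by blast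
  have CT: "?C \<inter> ?T = {}" using dj[of sx sx ?N sy] sK by blast
  have AC: "?A \<inter> ?C = {}" using dj[of ?K sx sy ?N] sK by blast
  have GT: "?G \<inter> ?T = {}" using dj[of ?K sx ?N sy] sK by blast
  have GA: "?G \<inter> ?A = {}" using dj[of ?K ?K ?N sy] sK by blast
  have GC: "?G \<inter> ?C = {}" using dj[of ?K sx ?N ?N] sK by blast
  have yK: "y \<notin> K" "x \<notin> N"
    using KN KL(2) NL(2) x0 y0 by blast+
  have "M \<inter> ssum K (vec.span {y}) - {0} = ?A \<union> ?T"
  proof
    show "M \<inter> ssum K (vec.span {y}) - {0} \<subseteq> ?A \<union> ?T"
    proof
      fix v assume v: "v \<in> M \<inter> ssum K (vec.span {y}) - {0}"
      then obtain k n where kn: "k \<in> K" "n \<in> vec.span {y}" "v = k + n" by (auto simp: ssum_def)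
      have "k \<noteq> 0 \<and> n \<noteq> 0" using nz[of k n] kn v sK(4) by blast
      then show "v \<in> ?A \<union> ?T" using kn v ssumI[of k ?K n sy] ssumI[of k sx n sy] by blast
    qed
    have "ssum ?K sy \<subseteq> ssum K (vec.span {y})" "ssum sx sy \<subseteq> ssum K (vec.span {y})"
      by (intro ssum_mono; use sK in blast)+
    then show "?A \<union> ?T \<subseteq> M \<inter> ssum K (vec.span {y}) - {0}" using z4 by blast
  qed
  moreover have "y \<in> ssum K N" "x \<in> ssum K N" using S KL NL by auto
  ultimately have "card (?A \<union> ?T) = q - 1"
    using card_line_Int_plane[OF KL(1) M(1,3) yK(1) S(1,4) M(2) S(2)] by simp
  then show 1: "card ?A + t = q - 1" using card_Un_disjoint[of ?A ?T] AT by (simp add: t_def)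
  have "M \<inter> ssum N (vec.span {x}) - {0} = ?C \<union> ?T"
  proof
    show "M \<inter> ssum N (vec.span {x}) - {0} \<subseteq> ?C \<union> ?T"
    proof
      fix v assume v: "v \<in> M \<inter> ssum N (vec.span {x}) - {0}"
      then have "v \<in> ssum (vec.span {x}) N" by (simp add: ssum_commute)
      then obtain k n where kn: "k \<in> vec.span {x}" "n \<in> N" "v = k + n" by (auto simp: ssum_def)
      have "k \<noteq> 0 \<and> n \<noteq> 0" using nz[of k n] kn v sK(3) by blast
      then show "v \<in> ?C \<union> ?T" using kn v ssumI[of k sx n ?N] ssumI[of k sx n sy] by blast
    qed
    have "ssum sx ?N \<subseteq> ssum (vec.span {x}) N" "ssum sx sy \<subseteq> ssum (vec.span {x}) N"
      by (intro ssum_mono; use sK in blast)+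
    then show "?C \<union> ?T \<subseteq> M \<inter> ssum N (vec.span {x}) - {0}"
      unfolding ssum_commute[of N] using z4 by blast
  qed
  moreover have "x \<in> ssum K N" using S KL by auto
  ultimately have "card (?C \<union> ?T) = q - 1"
    using card_line_Int_plane[OF NL(1) M(1,4) yK(2) S(1,4) M(2) S(3)] by simp
  then show 2: "card ?C + t = q - 1" using card_Un_disjoint[of ?C ?T] CT by (simp add: t_def)
  have "M - {0} = ?G \<union> (?A \<union> (?C \<union> ?T))"
  proof
    show "M - {0} \<subseteq> ?G \<union> (?A \<union> (?C \<union> ?T))"
    proof
      fix v assume v: "v \<in> M - {0}"
      then obtain k n where kn: "k \<in> K" "n \<in> N" "v = k + n" using M(2) by (auto simp: ssum_def)
      have "k \<noteq> 0 \<and> n \<noteq> 0" using nz[of k n] kn v by blast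
      then show "v \<in> ?G \<union> (?A \<union> (?C \<union> ?T))"
        using kn v ssumI[of k ?K n ?N] ssumI[of k ?K n sy] ssumI[of k sx n ?N] ssumI[of k sx n sy] by blast
    qed
    show "?G \<union> (?A \<union> (?C \<union> ?T)) \<subseteq> M - {0}" using z4 by blast
  qed
  moreover have "card (M - {0}) = q^2 - 1"
    using line_card[OF M(1)] vec.subspace_0[OF line_subspace[OF M(1)]] by simp
  ultimately have "q^2 - 1 = card (?G \<union> (?A \<union> (?C \<union> ?T)))" by simp
  also have "\<dots> = card ?G + card (?A \<union> (?C \<union> ?T))" using GA GC GT by (intro card_Un_disjoint) auto
  also have "card (?A \<union> (?C \<union> ?T)) = card ?A + card (?C \<union> ?T)" using AC AT by (intro card_Un_disjoint) auto
  also have "card (?C \<union> ?T) = q - 1" by fact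
  finally have 3: "q^2 - 1 = card ?G + (card ?A + (q - 1))" .
  obtain p where "q = Suc p" using q_gt_1 by (cases q) auto
  then show "card ?G = (q - 1)^2 + t" using 1 3 by (simp add: power2_eq_square)
qed

text \<open>By (Sd) the solid has at least \<open>q - 1\<close> lines besides \<open>K\<close> and
  \<open>N\<close>. They miss \<open>K\<close>, \<open>N\<close> and each other, so the counts of
  \<open>line_in_solid_count\<close> add up over them.\<close>

lemma solid_count_far:
  assumes K: "K \<in> thru x" and N: "N \<in> thru y" and nf: "N \<notin> near K"
  shows "\<exists>t. t \<le> np sx sy \<and> (q - 1)^2 \<le> np (K - vec.span {x}) sy + t
    \<and> (q - 1)^2 \<le> np sx (N - vec.span {y}) + t
    \<and> (q - 1)^3 + t \<le> np (K - vec.span {x}) (N - vec.span {y})"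
proof -
  note KL = thruD[OF K] and NL = thruD[OF N]
  have sub: "K \<subseteq> pl x" "N \<subseteq> pl y" using line_subset_pl KL NL by auto
  let ?K = "K - vec.span {x}" and ?N = "N - vec.span {y}"
  have sK: "sx \<subseteq> pl x" "sy \<subseteq> pl y" "?K \<subseteq> pl x" "?N \<subseteq> pl y" using spanx spany sub by auto
  let ?S = "ssum K N" and ?M = "lin (ssum K N) - {K, N}"
  note fs = far_solid[OF KL(1) NL(1) nf]
  have nf': "K \<notin> near N" using nf near_commute KL NL by blast
  note fs' = far_solid[OF NL(1) KL(1) nf', unfolded ssum_commute[of N K]]
  have memL: "M \<in> \<L>" "M \<subseteq> ?S" "M \<inter> K = {0}" "M \<inter> N = {0}" "M \<notin> near K" if M: "M \<in> ?M" for M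
  proof -
    show L: "M \<in> \<L>" "M \<subseteq> ?S" using M linD by auto
    show nK: "M \<notin> near K" using fs(4) M by blast
    have "M \<notin> near N" using fs'(4) M by blast
    from far_Int[OF NL(1) L(1) this] show "M \<inter> N = {0}" by (simp add: Int_commute)
    from far_Int[OF KL(1) L(1) nK] show "M \<inter> K = {0}" by (simp add: Int_commute)
  qed
  \<comment> \<open>The solid is also spanned by \<open>M\<close> and \<open>K\<close>, so
    \<open>far_solid\<close> applies with \<open>M\<close> in the role of the base line.\<close>
  have disj: "M \<inter> M' = {0}" if M: "M \<in> ?M" "M' \<in> ?M" "M \<noteq> M'" for M M'
  proof -
    have KM: "K \<notin> near M" using memL(5)[OF M(1)] near_commute[OF KL(1) memL(1)[OF M(1)]] by blast
    note f = far_solid[OF memL(1)[OF M(1)] KL(1) KM]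
    have "K \<subseteq> ?S" using line_subspace[OF NL(1)] by (simp add: ssum_upper1)
    then have "ssum M K \<subseteq> ?S" using fs(1) memL(2)[OF M(1)] by (intro ssum_least)
    then have "ssum M K = ?S" using f(1,2) fs(1,2) by (intro subspace_eqI) auto
    then have "M' \<notin> near M" using f(4)[of M'] M by auto
    then show ?thesis using far_Int[OF memL(1)[OF M(1)] memL(1)[OF M(2)]] by blast
  qed
  have cM: "q - 1 \<le> card ?M"
  proof -
    have "card (lin ?S) - card {K, N} \<le> card ?M" by (rule diff_card_le_card_Diff) simp
    moreover have "card {K, N} \<le> 2" by (simp add: card_insert_if)
    ultimately show ?thesis using fs(3) by linarith
  qed
  have le: "(\<Sum>M\<in>?M. card (M \<inter> ssum A B)) \<le> np A B"
    if AB: "A \<subseteq> pl x" "B \<subseteq> pl y" "0 \<notin> A" for A B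
  proof -
    have z: "0 \<notin> ssum A B" using zero_not_in_ssum[OF AB] .
    have "(M \<inter> ssum A B) \<inter> (M' \<inter> ssum A B) = {}" if "M \<in> ?M" "M' \<in> ?M" "M \<noteq> M'" for M M'
    proof (rule equals0I)
      fix v assume v: "v \<in> (M \<inter> ssum A B) \<inter> (M' \<inter> ssum A B)"
      then have "v \<in> M \<inter> M'" by simp
      then have "v = 0" unfolding disj[OF that] by simp
      then show False using v z by simp
    qed
    then have dd: "\<forall>M\<in>?M. \<forall>M'\<in>?M. M \<noteq> M' \<longrightarrow> (M \<inter> ssum A B) \<inter> (M' \<inter> ssum A B) = {}"
      by blast
    have "(\<Sum>M\<in>?M. card (M \<inter> ssum A B)) = card (\<Union>M\<in>?M. M \<inter> ssum A B)"
      by (rule card_UN_disjoint[OF _ _ dd, symmetric]) simp_all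
    also have "\<dots> \<le> np A B" unfolding np_def
    proof (intro card_mono)
      show "(\<Union>M\<in>?M. M \<inter> ssum A B) \<subseteq> pts \<inter> ssum A B"
      proof
        fix v assume "v \<in> (\<Union>M\<in>?M. M \<inter> ssum A B)"
        then obtain M where "M \<in> ?M" "v \<in> M" "v \<in> ssum A B" by blast
        moreover from this have "v \<noteq> 0" using z by blast
        ultimately show "v \<in> pts \<inter> ssum A B" using ptsI[of v M] memL(1)[of M] by blast
      qed
    qed simp
    finally show ?thesis .
  qed
  define t where "t = (\<Sum>M\<in>?M. card (M \<inter> ssum sx sy))"
  have zx: "0 \<notin> sx" "0 \<notin> ?K" using vec.span_zero[of "{x}"] by auto
  have sq: "(q - 1)^2 \<le> card ?M * (q - 1)" using mult_right_mono[OF cM, of "q - 1"] by (simp add: power2_eq_square)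
  have cnt: "card (M \<inter> ssum ?K sy) + card (M \<inter> ssum sx sy) = q - 1"
      "card (M \<inter> ssum sx ?N) + card (M \<inter> ssum sx sy) = q - 1"
      "card (M \<inter> ssum ?K ?N) = (q - 1)^2 + card (M \<inter> ssum sx sy)" if "M \<in> ?M" for M
    using line_in_solid_count[OF K N memL(1-4)[OF that]] by auto
  have "(\<Sum>M\<in>?M. card (M \<inter> ssum ?K sy)) + t = card ?M * (q - 1)"
    unfolding t_def sum.distrib[symmetric] using cnt(1) by simp
  then have 1: "(q - 1)^2 \<le> np ?K sy + t" using sq le[OF sK(3,2) zx(2)] by linarith
  have "(\<Sum>M\<in>?M. card (M \<inter> ssum sx ?N)) + t = card ?M * (q - 1)"
    unfolding t_def sum.distrib[symmetric] using cnt(2) by simp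
  then have 2: "(q - 1)^2 \<le> np sx ?N + t" using sq le[OF sK(1,4) zx(1)] by linarith
  have "(\<Sum>M\<in>?M. card (M \<inter> ssum ?K ?N)) = card ?M * (q - 1)^2 + t"
    unfolding t_def using cnt(3) by (simp add: sum.distrib)
  moreover have "(q - 1)^3 \<le> card ?M * (q - 1)^2"
    using mult_right_mono[OF cM, of "(q - 1)^2"] by (simp add: power3_eq_cube power2_eq_square)
  ultimately have 3: "(q - 1)^3 + t \<le> np ?K ?N" using le[OF sK(3,4) zx(2)] by linarith
  have "t \<le> np sx sy" unfolding t_def using le[OF sK(1,2) zx(1)] .
  then show ?thesis using 1 2 3 by blast
qed

text \<open>Here \<open>t\<close> counts the vectors of the line joining \<open>x\<close> and \<open>y\<close> that lie on lines of the solid: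
  such vectors are shared by all solids, but they are compensated by additional vectors in general
  position.\<close>

lemma solid_count:
  assumes K: "K \<in> thru x" and N: "N \<in> thru y"
  shows "\<exists>t. t \<le> np sx sy \<and> (q - 1)^2 \<le> np (K - vec.span {x}) sy + t
    \<and> (q - 1)^2 \<le> np sx (N - vec.span {y}) + t
    \<and> (q - 1)^3 + t \<le> np (K - vec.span {x}) (N - vec.span {y})"
proof (cases "N \<in> near K")
  case True
  show ?thesis using solid_count_near[OF K N True] by (intro exI[of _ 0]) simp
next
  case False
  then show ?thesis by (rule solid_count_far[OF K N])
qed

text \<open>The sum is cut along the partitions of both planes into the two planes themselves, the
  line joining \<open>x\<close> and \<open>y\<close>, and mixed and generic pieces for the lines of
  the pencils. The pieces are bounded by \<open>solid_count\<close>, and the deficits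
  \<open>t\<close> cancel.\<close>

lemma card_pts_two_planes:
  "(q - 1) * (q^4 + 2 * q^2 + 2 * q + 1) \<le> card (pts \<inter> ssum (pl x) (pl y))"
proof -
  let ?K = "\<lambda>K. K - vec.span {x}" and ?N = "\<lambda>N. N - vec.span {y}"
  have K: "?K K \<subseteq> pl x" if "K \<in> thru x" for K using that by (auto simp: pl_def)
  have s: "sx \<subseteq> pl x" "{0} \<subseteq> pl y" using spanx vec.subspace_0[OF pl_subspace[OF y]] by auto
  have pl0: "card (pts \<inter> pl z) = q^3 - 1" if z: "z \<in> pts" for z
  proof -
    have "pts \<inter> pl z = pl z - {0}" using pl_pts pts_nonzero by blast
    then show ?thesis using card_pl[OF z] vec.subspace_0[OF pl_subspace[OF z]] by simp
  qed
  have z1: "np {0} (pl y) = q^3 - 1" "np (pl x) {0} = q^3 - 1" "np {0} {0} = 0"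
    using pl0[OF x] pl0[OF y] pts_nonzero[of 0] by (auto simp: np_def ssum_zero1 ssum_zero2)
  have e: "np (pl x) (pl y) = (q^3 - 1) + (q^3 - 1) + np sx sy + (\<Sum>N\<in>thru y. np sx (?N N))
      + (\<Sum>K\<in>thru x. np (?K K) sy) + (\<Sum>K\<in>thru x. \<Sum>N\<in>thru y. np (?K K) (?N N))"
  proof -
    have "(\<Sum>K\<in>thru x. np (?K K) (pl y))
        = (\<Sum>K\<in>thru x. np (?K K) {0} + np (?K K) sy + (\<Sum>N\<in>thru y. np (?K K) (?N N)))"
      using np_split2[OF K] by (intro sum.cong) auto
    then show ?thesis
      using np_split1[of "pl y"] np_split2[OF s(1)] np_split1[OF s(2)] z1 by (simp add: sum.distrib)
  qed
  let ?Q = "\<lambda>K N t. t \<le> np sx sy \<and> (q - 1)^2 \<le> np (?K K) sy + t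
    \<and> (q - 1)^2 \<le> np sx (?N N) + t \<and> (q - 1)^3 + t \<le> np (?K K) (?N N)"
  \<comment> \<open>One deficit is fixed per pair, so that the losses and the gain supplied by
    \<open>solid_count\<close> refer to the same number.\<close>
  define t where "t K N = (SOME t. ?Q K N t)" for K N
  have "?Q K N (t K N)" if "K \<in> thru x" "N \<in> thru y" for K N
    unfolding t_def using solid_count[OF that] by (rule someI_ex)
  then have t: "t K N \<le> np sx sy" "(q - 1)^2 \<le> np (?K K) sy + t K N"
      "(q - 1)^2 \<le> np sx (?N N) + t K N" "(q - 1)^3 + t K N \<le> np (?K K) (?N N)"
    if "K \<in> thru x" "N \<in> thru y" for K N
    using that by blast+
  \<comment> \<open>A mixed piece of a line \<open>K\<close> with \<open>sy\<close> is shared by all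
    \<open>N\<close>, so it is bounded once, with the fixed partner \<open>N0\<close>; likewise
    \<open>K0\<close> serves for the mixed pieces with \<open>sx\<close>.\<close>
  obtain K0 where K0: "K0 \<in> thru x" using two_thru[OF x] by blast
  obtain N0 where N0: "N0 \<in> thru y" using two_thru[OF y] by blast
  note cx = card_thru[OF x] and cy = card_thru[OF y]
  have "(\<Sum>K\<in>thru x. (q - 1)^2) \<le> (\<Sum>K\<in>thru x. np (?K K) sy + t K N0)"
    using t(2)[OF _ N0] by (intro sum_mono)
  then have 1: "(q + 1) * (q - 1)^2 \<le> (\<Sum>K\<in>thru x. np (?K K) sy) + (\<Sum>K\<in>thru x. t K N0)"
    using cx by (simp add: sum.distrib)
  have "(\<Sum>N\<in>thru y. (q - 1)^2) \<le> (\<Sum>N\<in>thru y. np sx (?N N) + t K0 N)"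
    using t(3)[OF K0] by (intro sum_mono)
  then have 2: "(q + 1) * (q - 1)^2 \<le> (\<Sum>N\<in>thru y. np sx (?N N)) + (\<Sum>N\<in>thru y. t K0 N)"
    using cy by (simp add: sum.distrib)
  have "(\<Sum>K\<in>thru x. \<Sum>N\<in>thru y. (q - 1)^3 + t K N) \<le> (\<Sum>K\<in>thru x. \<Sum>N\<in>thru y. np (?K K) (?N N))"
    using t(4) by (intro sum_mono)
  then have 3: "(q + 1) * ((q + 1) * (q - 1)^3) + (\<Sum>K\<in>thru x. \<Sum>N\<in>thru y. t K N)
      \<le> (\<Sum>K\<in>thru x. \<Sum>N\<in>thru y. np (?K K) (?N N))"
    using cx cy by (simp add: sum.distrib)
  \<comment> \<open>The losses form one column and one row of the table of all \<open>t K N\<close>,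
    overlapping only at the pair \<open>K0\<close>, \<open>N0\<close>. The generic pieces gain the
    whole table, and \<open>np sx sy\<close> pays for the overlap.\<close>
  have "(\<Sum>K\<in>thru x. \<Sum>N\<in>thru y. t K N)
      = (\<Sum>K\<in>thru x. t K N0) + (\<Sum>K\<in>thru x. \<Sum>N\<in>thru y - {N0}. t K N)"
    using N0 by (simp add: sum.remove[of "thru y" N0] sum.distrib)
  moreover have "(\<Sum>N\<in>thru y - {N0}. t K0 N) \<le> (\<Sum>K\<in>thru x. \<Sum>N\<in>thru y - {N0}. t K N)"
    using K0 by (intro member_le_sum[of K0]) auto
  moreover have "(\<Sum>N\<in>thru y. t K0 N) = t K0 N0 + (\<Sum>N\<in>thru y - {N0}. t K0 N)"
    using N0 by (simp add: sum.remove)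
  ultimately have 4: "(\<Sum>K\<in>thru x. t K N0) + (\<Sum>N\<in>thru y. t K0 N)
      \<le> (\<Sum>K\<in>thru x. \<Sum>N\<in>thru y. t K N) + np sx sy"
    using t(1)[OF K0 N0] by linarith
  have "2 * (q^3 - 1) + 2 * ((q + 1) * (q - 1)^2) + (q + 1) * ((q + 1) * (q - 1)^3) \<le> np (pl x) (pl y)"
    unfolding e using 1 2 3 4 by linarith
  moreover have "2 * (q^3 - 1) + 2 * ((q + 1) * (q - 1)^2) + (q + 1) * ((q + 1) * (q - 1)^3)
      = (q - 1) * (q^4 + 2 * q^2 + 2 * q + 1)"
  proof -
    obtain p where p: "q = Suc p" using q_gt_1 by (cases q) auto
    show ?thesis unfolding p by (simp add: power_numeral_reduce algebra_simps)
  qed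
  ultimately show ?thesis by (simp add: np_def)
qed

end

section \<open>The dimension bound\<close>

context line_set
begin

text \<open>There are as many points as lines, since every line has \<open>q + 1\<close> points and
  every point is on \<open>q + 1\<close> lines; \<open>q - 1\<close> vectors represent a
  point.\<close>

lemma card_pts: "card pts = (q - 1) * card \<L>"
proof -
  have "(\<Sum>v\<in>pts. card {M \<in> \<L>. v \<in> M}) = (q^2 - 1) * card \<L>"
  proof (rule sum_multicount)
    show "\<forall>M\<in>\<L>. card {v \<in> pts. v \<in> M} = q^2 - 1"
    proof
      fix M assume M: "M \<in> \<L>"
      have "{v \<in> pts. v \<in> M} = M - {0}" using M by (auto simp: pts_def thru_def)
      then show "card {v \<in> pts. v \<in> M} = q^2 - 1"
        using line_card[OF M] vec.subspace_0[OF line_subspace[OF M]] by simp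
    qed
  qed auto
  moreover have "card {M \<in> \<L>. v \<in> M} = q + 1" if "v \<in> pts" for v
    using card_thru[OF that] by (simp add: thru_def)
  ultimately have "card pts * (q + 1) = (q^2 - 1) * card \<L>" by simp
  also have "q^2 - 1 = (q - 1) * (q + 1)" by (simp add: power2_eq_square algebra_simps)
  finally have "card pts * (q + 1) = ((q - 1) * card \<L>) * (q + 1)" by (simp only: ac_simps)
  then show ?thesis unfolding mult_cancel2 by simp
qed

lemma pl_Int_span:
  assumes "z \<in> pts" "v \<in> pts" "v \<notin> pl z" "d \<in> pl v" "d \<noteq> 0"
  shows "d \<notin> vec.span {z}"
proof
  assume "d \<in> vec.span {z}"
  from span1_commute[OF assms(5) this] have "z \<in> pl v"
    using span_subset_subspace[OF pl_subspace[OF assms(2)] assms(4)] by blast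
  then show False using assms(3) pl_commute by blast
qed

text \<open>Every point outside \<open>pl z\<close> is collinear with a point of \<open>pl z\<close>
  other than \<open>z\<close>. There are \<open>q^2 + q\<close> of the latter, and each reaches at
  most \<open>q^2\<close> points outside \<open>pl z\<close>, because its own pencil plane shares
  with \<open>pl z\<close> the line to \<open>z\<close>.\<close>

lemma card_lines_no_far_points:
  assumes z: "z \<in> pts" and nofar: "\<And>y. y \<in> pts \<Longrightarrow> pl z \<inter> pl y \<noteq> {0}"
  shows "card \<L> \<le> q^4 + q^3 + q^2 + q + 1"
proof -
  note sz = pl_subspace[OF z]
  let ?D = "pl z - vec.span {z}" and ?E = "pts - pl z"
  have z0: "z \<noteq> 0" using z by (rule pts_nonzero)
  have szz: "vec.span {z} \<subseteq> pl z" using span_subset_subspace[OF sz pl_self[OF z]] .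
  have cD: "card ?D = q^3 - q"
    using card_pl[OF z] card_span1[OF z0] szz q_def by (simp add: card_Diff_subset)
  have swap: "(\<Sum>v\<in>?E. card {d \<in> ?D. v \<in> pl d}) = (\<Sum>d\<in>?D. card {v \<in> ?E. v \<in> pl d})"
    by (rule sum_multicount_gen) auto
  have lo: "q - 1 \<le> card {d \<in> ?D. v \<in> pl d}" if v: "v \<in> ?E" for v
  proof -
    have vP: "v \<in> pts" "v \<notin> pl z" using v by auto
    note sv = pl_subspace[OF vP(1)]
    obtain d0 where d0: "d0 \<noteq> 0" "d0 \<in> pl z" "d0 \<in> pl v"
      using nofar[OF vP(1)] vec.subspace_0[OF sz] vec.subspace_0[OF sv] by blast
    have "vec.span {d0} - {0} \<subseteq> {d \<in> ?D. v \<in> pl d}"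
    proof
      fix d assume d: "d \<in> vec.span {d0} - {0}"
      then have "d \<in> pl z" "d \<in> pl v" "d \<noteq> 0"
        using span_subset_subspace[OF sz d0(2)] span_subset_subspace[OF sv d0(3)] by auto
      then show "d \<in> {d \<in> ?D. v \<in> pl d}" using pl_Int_span[OF z vP] pl_commute by blast
    qed
    then have "card (vec.span {d0} - {0}) \<le> card {d \<in> ?D. v \<in> pl d}" by (intro card_mono) auto
    then show ?thesis using card_span1[OF d0(1)] q_def by (simp add: vec.span_zero)
  qed
  have hi: "card {v \<in> ?E. v \<in> pl d} \<le> q^3 - q^2" if d: "d \<in> ?D" for d
  proof -
    have d0: "d \<noteq> 0" using d vec.span_zero[of "{z}"] by blast
    have dP: "d \<in> pts" using d d0 pl_pts by blast
    obtain T where T: "T \<in> \<L>" "z \<in> T" "d \<in> T" using d by (auto simp: mem_pl)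
    have Ts: "T \<subseteq> pl d \<inter> pl z" using line_subset_pl T by blast
    have "{v \<in> ?E. v \<in> pl d} \<subseteq> pl d - T" using Ts by blast
    then have "card {v \<in> ?E. v \<in> pl d} \<le> card (pl d - T)" by (intro card_mono) auto
    also have "\<dots> = q^3 - q^2"
      using Ts card_pl[OF dP] line_card[OF T(1)] by (simp add: card_Diff_subset)
    finally show ?thesis .
  qed
  have "(\<Sum>v\<in>?E. q - 1) \<le> (\<Sum>v\<in>?E. card {d \<in> ?D. v \<in> pl d})" using lo by (intro sum_mono)
  also have "\<dots> \<le> (\<Sum>d\<in>?D. q^3 - q^2)" unfolding swap using hi by (intro sum_mono)
  finally have le: "card ?E * (q - 1) \<le> (q^3 - q) * (q^3 - q^2)" using cD by simp
  obtain p where p: "q = Suc p" using q_gt_1 by (cases q) auto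
  have "(q^3 - q) * (q^3 - q^2) = (q * (q + 1) * (q^3 - q^2)) * (q - 1)"
    unfolding p by (simp add: power_numeral_reduce algebra_simps)
  then have E: "card ?E \<le> q * (q + 1) * (q^3 - q^2)" using le q_gt_1 by simp
  have "card pts \<le> card ((pl z - {0}) \<union> ?E)" using pts_nonzero by (intro card_mono) auto
  also have "\<dots> \<le> card (pl z - {0}) + card ?E" by (rule card_Un_le)
  also have "card (pl z - {0}) = q^3 - 1" using card_pl[OF z] vec.subspace_0[OF sz] by simp
  finally have "(q - 1) * card \<L> \<le> (q^3 - 1) + q * (q + 1) * (q^3 - q^2)" using E card_pts by simp
  also have "\<dots> = (q - 1) * (q^4 + q^3 + q^2 + q + 1)"
    unfolding p by (simp add: power_numeral_reduce algebra_simps)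
  finally have "(q - 1) * card \<L> \<le> (q - 1) * (q^4 + q^3 + q^2 + q + 1)" .
  moreover have "0 < q - 1" using q_gt_1 by simp
  ultimately show ?thesis unfolding mult_le_cancel1 by blast
qed

lemma pl_subset_span: "pl a \<subseteq> vec.span (\<Union>\<L>)"
proof -
  have "pl a \<subseteq> \<Union>\<L>" by (auto simp: mem_pl)
  then show ?thesis using vec.span_superset by blast
qed

text \<open>The pencil planes of two different collinear points share at most a line, so together
  they have at least \<open>2 * (q^2 + q + 1) - (q + 1)\<close> points.\<close>

lemma card_pts_collinear_planes:
  assumes z: "z \<in> pts"
  obtains X where "vec.subspace X" "X \<subseteq> vec.span (\<Union>\<L>)" "vec.dim X \<le> 6"
    "(q - 1) * (2 * q^2 + q + 1) \<le> card (pts \<inter> X)"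
proof -
  note sz = pl_subspace[OF z] and dz = pl_dim[OF z]
  have z0: "z \<noteq> 0" using z by (rule pts_nonzero)
  have "pl z \<noteq> vec.span {z}" using dz dim_span1[OF z0] by auto
  moreover have "vec.span {z} \<subseteq> pl z" using span_subset_subspace[OF sz pl_self[OF z]] .
  ultimately obtain c where c: "c \<in> pl z" "c \<notin> vec.span {z}" by blast
  have c0: "c \<noteq> 0" using c vec.span_zero[of "{z}"] by blast
  have cP: "c \<in> pts" using c c0 pl_pts by blast
  note sc = pl_subspace[OF cP] and dc = pl_dim[OF cP]
  have "\<not> pl z \<subseteq> pl c"
  proof
    \<comment> \<open>Equal planes would mean equal pencils, and two lines of the pencil would share
      both points \<open>z\<close> and \<open>c\<close>.\<close>
    assume "pl z \<subseteq> pl c"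
    then have "pl z = pl c" using sz sc dz dc by (intro subspace_eqI) auto
    then have e: "thru z = thru c" using lin_pl[OF z] lin_pl[OF cP] by simp
    obtain M1 M2 where M: "M1 \<in> thru z" "M2 \<in> thru z" "M1 \<noteq> M2" using two_thru[OF z] .
    then have "M1 \<inter> M2 = vec.span {z}" using thruD z0 by (intro lines_Int) auto
    moreover have "c \<in> M1 \<inter> M2" using M e thruD by blast
    ultimately show False using c by blast
  qed
  then have "vec.dim (pl z \<inter> pl c) \<le> 2" using dim_Int_less[OF sz sc] dz by simp
  moreover have sI: "vec.subspace (pl z \<inter> pl c)" using sz sc by (simp add: vec.subspace_inter)
  ultimately have cI: "card (pl z \<inter> pl c) \<le> q^2"
    using card_sub[OF sI] power_increasing[of "vec.dim (pl z \<inter> pl c)" 2 q] q_gt_1 by simp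
  let ?X = "ssum (pl z) (pl c)"
  have X: "vec.subspace ?X" "pl z \<subseteq> ?X" "pl c \<subseteq> ?X"
    using sz sc by (simp_all add: subspace_ssum ssum_upper1 ssum_upper2)
  have "?X \<subseteq> vec.span (\<Union>\<L>)" by (intro ssum_least pl_subset_span) simp
  moreover have "vec.dim ?X \<le> 6" using dim_ssum[OF sz sc] dz dc by linarith
  moreover have "(q - 1) * (2 * q^2 + q + 1) \<le> card (pts \<inter> ?X)"
  proof -
    have "pl z \<union> pl c - {0} \<subseteq> pts \<inter> ?X" using X pl_pts by blast
    then have "card (pl z \<union> pl c - {0}) \<le> card (pts \<inter> ?X)" by (intro card_mono) auto
    moreover have "card (pl z \<union> pl c - {0}) = card (pl z \<union> pl c) - 1"
      using vec.subspace_0[OF sz] by (simp add: card_Diff_singleton)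
    moreover have "card (pl z \<union> pl c) + card (pl z \<inter> pl c) = q^3 + q^3"
      using card_Un_Int[of "pl z" "pl c"] card_pl[OF z] card_pl[OF cP] by simp
    moreover have "(q - 1) * (2 * q^2 + q + 1) + q^2 + 1 = q^3 + q^3"
    proof -
      obtain p where p: "q = Suc p" using q_gt_1 by (cases q) auto
      show ?thesis unfolding p by (simp add: power_numeral_reduce algebra_simps)
    qed
    ultimately show ?thesis using cI by linarith
  qed
  ultimately show ?thesis using that X by blast
qed

text \<open>Here \<open>k\<close> is a lower bound for the number of points in \<open>X\<close>.
  Since the span has dimension at least 8, \<open>X\<close> fits into a subspace of codimension two;
  averaging finds a hyperplane with at least \<open>k\<close> lines, to which the upper bound for
  hyperplanes applies.\<close>

lemma card_lines_lower_bound: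
  assumes X: "vec.subspace X" "X \<subseteq> vec.span (\<Union>\<L>)" "vec.dim X \<le> 6"
    and c: "(q - 1) * k \<le> card (pts \<inter> X)" and d: "8 \<le> vec.dim (vec.span (\<Union>\<L>))"
  shows "q * k + (q^4 + q^3 + q^2 + q + 1) \<le> card \<L> + q * (1 + 2 * q^2)"
proof -
  let ?U = "vec.span (\<Union>\<L>)"
  have U: "vec.subspace ?U" "\<Union>\<L> \<subseteq> ?U" by (auto intro: vec.span_base)
  obtain C where C: "vec.subspace C" "X \<subseteq> C" "C \<subseteq> ?U" "vec.dim C = vec.dim ?U - 2"
  proof -
    have "vec.dim X \<le> vec.dim ?U - 2" "vec.dim ?U - 2 \<le> vec.dim ?U" using X(3) d by linarith+
    from subspace_extend[OF X(1,2) U(1) this] show ?thesis using that by blast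
  qed
  have dC: "vec.dim C + 2 = vec.dim ?U" using C d by linarith
  obtain H where H: "vec.subspace H" "C \<subseteq> H" "H \<subseteq> ?U" "vec.dim H + 1 = vec.dim ?U"
    "card (pts \<inter> C) \<le> (q - 1) * card (lin H)"
    using ex_rich_hyperplane[OF U C(1,3) dC] .
  interpret hyp: line_set_hyperplane \<L> q ?U H by unfold_locales (use U H in auto)
  have "\<exists>K\<in>\<L>. \<not> K \<subseteq> H"
  proof (rule ccontr)
    assume "\<not> ?thesis"
    then have "?U \<subseteq> H" using H(1) by (intro vec.span_minimal) auto
    then show False using vec.dim_subset[of ?U H] H(4) by simp
  qed
  then obtain K where K: "K \<in> \<L>" "\<not> K \<subseteq> H" by blast
  have "card (pts \<inter> X) \<le> card (pts \<inter> C)" using C by (intro card_mono) auto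
  then have "(q - 1) * k \<le> (q - 1) * card (lin H)" using c H(5) by linarith
  then have "k \<le> card (lin H)" using q_gt_1 by simp
  then have "q * k \<le> q * card (lin H)" by simp
  then show ?thesis using hyp.card_lin_hyperplane[OF K] by linarith
qed

text \<open>Vector dimension 7 is projective dimension 6. In dimension at least 8, the two pencil
  planes spanning dimension at most 6 can be fed into \<open>card_lines_lower_bound\<close>.\<close>

lemma dim_span_le_7:
  assumes ne: "\<L> \<noteq> {}" and To: "card \<L> \<le> q^5 + q^4 + q^3 + q^2 + q + 1"
  shows "vec.dim (vec.span (\<Union>\<L>)) \<le> 7"
proof (rule ccontr)
  let ?U = "vec.span (\<Union>\<L>)"
  assume "\<not> ?thesis"
  then have d: "8 \<le> vec.dim ?U" by linarith
  obtain M where M: "M \<in> \<L>" using ne by blast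
  obtain z where "z \<in> M" "z \<noteq> 0" using subspace_nonzero[OF line_subspace[OF M]] line_dim[OF M] by auto
  then have z: "z \<in> pts" using M by (intro ptsI)
  show False
  proof (cases "\<exists>y\<in>pts. pl z \<inter> pl y = {0}")
    case True
    then obtain y where y: "y \<in> pts" "pl z \<inter> pl y = {0}" by blast
    interpret fp: far_points \<L> q z y by unfold_locales (use z y in auto)
    let ?X = "ssum (pl z) (pl y)"
    have "vec.subspace ?X" using z y by (simp add: subspace_ssum pl_subspace)
    moreover have "?X \<subseteq> ?U" by (intro ssum_least pl_subset_span) simp
    moreover have "vec.dim ?X \<le> 6"
      using dim_ssum[OF pl_subspace[OF z] pl_subspace[OF y(1)]] pl_dim[OF z] pl_dim[OF y(1)] by linarith
    ultimately have "q * (q^4 + 2 * q^2 + 2 * q + 1) + (q^4 + q^3 + q^2 + q + 1) \<le> card \<L> + q * (1 + 2 * q^2)"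
      using fp.card_pts_two_planes d by (intro card_lines_lower_bound)
    then have "q * (q^4 + 2 * q^2 + 2 * q + 1) \<le> q^5 + q * (1 + 2 * q^2)" using To by linarith
    \<comment> \<open>All terms cancel except \<open>2 * q^2\<close> on the left.\<close>
    then show False using q_gt_1 by (simp add: power_numeral_reduce algebra_simps)
  next
    case False
    then have le: "card \<L> \<le> q^4 + q^3 + q^2 + q + 1" using z by (intro card_lines_no_far_points) auto
    obtain X where X: "vec.subspace X" "X \<subseteq> ?U" "vec.dim X \<le> 6" "(q - 1) * (2 * q^2 + q + 1) \<le> card (pts \<inter> X)"
      using card_pts_collinear_planes[OF z] .
    \<comment> \<open>The stronger bound \<open>le\<close> cancels the whole number of near lines,
      and the surplus \<open>q * q\<close> on the left remains.\<close>
    have "q * (2 * q^2 + q + 1) \<le> q * (1 + 2 * q^2)"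
      using card_lines_lower_bound[OF X d] le by linarith
    then show False using q_gt_1 by simp
  qed
qed

end

theorem theorem3:
  fixes \<L> :: "('a::{field,finite} ^ 'n) set set"
  defines "q \<equiv> CARD('a)"
  assumes n2: "CARD('n) \<ge> 3"
    and lines: "\<forall>L\<in>\<L>. pg_line L"
    and nonempty: "\<L> \<noteq> {}"
    and Pt: "\<forall>P. pg_point P \<longrightarrow> card {L\<in>\<L>. P \<subseteq> L} \<in> {0, q + 1}"
    and Pl: "\<forall>\<pi>. pg_plane \<pi> \<longrightarrow> card {L\<in>\<L>. L \<subseteq> \<pi>} \<in> {0, 1, q + 1}"
    and Sd: "\<forall>S. pg_solid S \<longrightarrow> card {L\<in>\<L>. L \<subseteq> S} \<in> {0, 1, q + 1, 2 * q + 1}"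
    and To: "card \<L> \<le> q^5 + q^4 + q^3 + q^2 + q + 1"
  shows "vec.dim (vec.span (\<Union>\<L>)) - 1 \<le> 6"
proof -
  interpret line_set \<L> q
    by unfold_locales (use assms in simp_all)
  show ?thesis using dim_span_le_7[OF nonempty To] by linarith
qed

end
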